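(* Let the model, the state space $\Omega$, the constants, the functions $V_{i,j}, U_i, \kappa_{i,j}, g_1, g_2, f_1, f_2$, the function $H_R$ and the feedback laws $F_i(w),\delta_i(w)$ be as defined in the context. Then for every $w_0\in\Omega$ the initial-value problem consisting, for $i=1,\dots,n$, of $$\dot r_i=-v_i\sin(s_i),\quad \dot\varphi_i=\frac{v_i}{r_i}\cos(s_i),\quad \dot s_i=\frac{v_i}{\sigma_i}\tan(\delta_i)-\frac{v_i}{r_i}\cos(s_i),\quad \dot v_i=F_i,$$ with $F_i=F_i(w)$, $\delta_i=\delta_i(w)$ and $w(0)=w_0$, has a unique solution $w(t)$, defined for all $t\ge 0$, that satisfies $w(t)\in\Omega$ for all $t\ge 0$, as well as $$\lim_{t\to+\infty}s_i(t)=0,\qquad \lim_{t\to+\infty}\frac{v_i(t)}{r_i(t)}=\omega^*,\qquad \lim_{t\to+\infty}\dot s_i(t)=0,\qquad \lim_{t\to+\infty}F_i(t)=0,\qquad i=1,\dots,n.$$ Furthermore, there exists a non-decreasing function $P_2:\mathbb R_+\to\mathbb R_+$ (not depending on $w_0$) such that, for every $w_0\in\Omega$, the corresponding solution satisfies $$|F_i(t)|+|\delta_i(t)|\le P_2(H_R(w_0))\quad\text{for all } t\ge 0,\ i=1,\dots,n.$$ Here $F_i(t)=F_i(w(t))$ and $\delta_i(t)=\delta_i(w(t))$.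
   Context: Notation: $\mathbb R_+=[0,+\infty)$. $n$ is a positive integer (number of vehicles). All sums $\sum_{j\ne i}$ run over $j\in\{1,\dots,n\}\setminus\{i\}$. Constants: $R_{out}>R_{in}>0$; $v_{\max}>0$; $\omega^*\in(0,v_{\max}/R_{out})$; $\Theta\in(0,\pi/2)$ with $\cos(\Theta)>R_{out}\omega^*/v_{\max}$; $\sigma_i>0$ ($i=1,\dots,n$); for $i\ne j$, $p_{i,j}=p_{j,i}>0$ and $L_{i,j}=L_{j,i}>0$; $\lambda>\max\{L_{i,j}: i\neq j\}$, $\lambda>0$; $A>0$; $b>1/R_{in}^2$. State: $w=(r_1,\dots,r_n,\varphi_1,\dots,\varphi_n,s_1,\dots,s_n,v_1,\dots,v_n)'\in\mathbb R^{4n}$. Distances: $d_{i,j}=\sqrt{p_{i,j}(r_i-r_j)^2+2r_ir_j(1-\cos(\varphi_i-\varphi_j))}$. Set $S=(R_{in},R_{out})^n\times\mathbb R^n\times(-\Theta,\Theta)^n\times(0,v_{\max})^n$ and state space $\Omega=\{w\in S: d_{i,j}>L_{i,j},\ i,j=1,\dots,n,\ j\ne i\}$ (an open set). Functions: for $i\neq j$, $V_{i,j}:(L_{i,j},+\infty)\to\mathbb R_+$ is $C^2$ with $\lim_{d\to L_{i,j}^+}V_{i,j}(d)=+\infty$, $V_{i,j}(d)=0$ for $d\ge\lambda$, $V_{i,j}\equiv V_{j,i}$; $U_i:(R_{in},R_{out})\to\mathbb R_+$ is $C^2$ with $\lim_{r\to R_{in}^+}U_i(r)=\lim_{r\to R_{out}^-}U_i(r)=+\infty$;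 for $i\ne j$, $\kappa_{i,j}:(L_{i,j},+\infty)\to\mathbb R_+$ is $C^1$ with $\kappa_{i,j}\equiv\kappa_{j,i}$ and $\kappa_{i,j}(d)=0$ for $d\ge\lambda$; $g_1,g_2:\mathbb R\to\mathbb R$ are $C^1$ and non-decreasing; $f_1,f_2:\mathbb R\to\mathbb R$ are $C^1$ with $f_k(0)=0$ and $xf_k(x)>0$ for $x\neq0$, $k=1,2$. Lyapunov function: for $w\in\Omega$, $$H_R(w)=\frac12\sum_{i=1}^n\frac{\big(\frac{v_i}{r_i}\cos(s_i)-\omega^*\big)^2+bv_i^2\sin^2(s_i)}{(v_{\max}-v_i)v_i}+\sum_{i=1}^nU_i(r_i)+\frac12\sum_{i=1}^n\sum_{j\ne i}V_{i,j}(d_{i,j})+A\sum_{i=1}^n\Big(\frac1{\cos(s_i)-\cos(\Theta)}-\frac1{1-\cos(\Theta)}\Big).$$ Feedback laws (Pseudo-Relativistic Cruise Controller): for $w\in\Omega$ and $i=1,\dots,n$, $$F_i=-\frac1{q(r_i,s_i,v_i)}\Big(f_1\Big(\frac{v_i}{r_i}\cos(s_i)-\omega^*\Big)+\omega^*\big(\Phi_i(w)-G_i(w)\big)\Big),$$ $$\delta_i=\tan^{-1}\Big(\frac{\sigma_i}{r_i}\cos(s_i)-\frac{\sigma_i}{\gamma(r_i,s_i,v_i)v_i}\big(f_2(\sin(s_i))+(\zeta(s_i,v_i)F_i+Z_i(w))v_i-M_i(w)\big)\Big),$$ where $$q(r,s,v)=\frac{v_{\max}v\cos(s)-2rv\omega^*+r\omega^*v_{\max}}{2r(v_{\max}-v)^2v^2},$$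 $$\gamma(r,s,v)=\frac{A}{(\cos(s)-\cos(\Theta))^2}+\frac{v\cos(s)}{v_{\max}-v}\Big(b-\frac1{r^2}\Big)+\frac{\omega^*}{r(v_{\max}-v)},\qquad \zeta(s,v)=\frac{bv_{\max}\sin(s)}{2(v_{\max}-v)^2v},$$ $$Z_i(w)=\Big(\frac{v_i}{r_i}\cos(s_i)-\omega^*\Big)\frac{\cos(s_i)}{(v_{\max}-v_i)r_i^2}-U_i'(r_i)-\sum_{j\ne i}\big(p_{i,j}(r_i-r_j)+r_j(1-\cos(\varphi_i-\varphi_j))\big)\frac{V_{i,j}'(d_{i,j})}{d_{i,j}},$$ $$\Phi_i(w)=\frac{r_i}{\omega^*}\sum_{j\ne i}V_{i,j}'(d_{i,j})\frac{r_j\sin(\varphi_i-\varphi_j)}{d_{i,j}},$$ $$G_i(w)=\frac1{\omega^*}\sum_{j\ne i}\kappa_{i,j}(d_{i,j})\Big(g_1\Big(\frac{v_j}{r_j}\cos(s_j)\Big)-g_1\Big(\frac{v_i}{r_i}\cos(s_i)\Big)\Big),$$ $$M_i(w)=\sum_{j\ne i}\kappa_{i,j}(d_{i,j})\big(g_2(\sin(s_j))-g_2(\sin(s_i))\big).$$ *)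

theory Defs
  imports "HOL-Analysis.Analysis"
begin

text \<open>
  The vehicles are indexed by a finite type \<open>'n\<close>.  Values of the two-index fields at \<open>i = j\<close>, and
  values of the functions outside the domains named in \<open>admissible\<close>, are irrelevant.
\<close>

record 'n params =
  Rin :: real
  Rout :: real
  vmax :: real
  omega :: real
  Theta :: real
  sigma :: "'n \<Rightarrow> real"
  pcoef :: "'n \<Rightarrow> 'n \<Rightarrow> real"
  Lmin :: "'n \<Rightarrow> 'n \<Rightarrow> real"
  lam :: real
  Acoef :: real
  bcoef :: real
  Vpot :: "'n \<Rightarrow> 'n \<Rightarrow> real \<Rightarrow> real"
  Upot :: "'n \<Rightarrow> real \<Rightarrow> real"
  kappa :: "'n \<Rightarrow> 'n \<Rightarrow> real \<Rightarrow> real"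
  g1 :: "real \<Rightarrow> real"
  g2 :: "real \<Rightarrow> real"
  f1 :: "real \<Rightarrow> real"
  f2 :: "real \<Rightarrow> real"

definition C2_differentiable_on :: "(real \<Rightarrow> real) \<Rightarrow> real set \<Rightarrow> bool"
    (infix \<open>C2'_differentiable'_on\<close> 50) where
  \<comment> \<open>only used for open sets, where \<open>deriv f\<close> on the set depends only on \<open>f\<close> on the set\<close>
  "f C2_differentiable_on S \<longleftrightarrow>
     f C1_differentiable_on S \<and> deriv f C1_differentiable_on S"

definition admissible :: "'n::finite params \<Rightarrow> bool" where
  "admissible P \<longleftrightarrow>
     0 < Rin P \<and> Rin P < Rout P \<and> 0 < vmax P \<and>
     0 < omega P \<and> omega P < vmax P / Rout P \<and>
     0 < Theta P \<and> Theta P < pi / 2 \<and> cos (Theta P) > Rout P * omega P / vmax P \<and>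
     (\<forall>i. 0 < sigma P i) \<and>
     (\<forall>i j. i \<noteq> j \<longrightarrow> pcoef P i j = pcoef P j i \<and> 0 < pcoef P i j) \<and>
     (\<forall>i j. i \<noteq> j \<longrightarrow> Lmin P i j = Lmin P j i \<and> 0 < Lmin P i j) \<and>
     (\<forall>i j. i \<noteq> j \<longrightarrow> Lmin P i j < lam P) \<and> 0 < lam P \<and>
     0 < Acoef P \<and> bcoef P > 1 / (Rin P)\<^sup>2 \<and>
     (\<forall>i j. i \<noteq> j \<longrightarrow>
        (\<forall>d > Lmin P i j. 0 \<le> Vpot P i j d \<and> Vpot P i j d = Vpot P j i d) \<and>
        Vpot P i j C2_differentiable_on {Lmin P i j <..} \<and>
        filterlim (Vpot P i j) at_top (at_right (Lmin P i j)) \<and>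
        (\<forall>d \<ge> lam P. Vpot P i j d = 0)) \<and>
     (\<forall>i. (\<forall>r \<in> {Rin P <..< Rout P}. 0 \<le> Upot P i r) \<and>
        Upot P i C2_differentiable_on {Rin P <..< Rout P} \<and>
        filterlim (Upot P i) at_top (at_right (Rin P)) \<and>
        filterlim (Upot P i) at_top (at_left (Rout P))) \<and>
     (\<forall>i j. i \<noteq> j \<longrightarrow>
        (\<forall>d > Lmin P i j. 0 \<le> kappa P i j d \<and> kappa P i j d = kappa P j i d) \<and>
        kappa P i j C1_differentiable_on {Lmin P i j <..} \<and>
        (\<forall>d \<ge> lam P. kappa P i j d = 0)) \<and>
     g1 P C1_differentiable_on UNIV \<and> mono (g1 P) \<and>
     g2 P C1_differentiable_on UNIV \<and> mono (g2 P) \<and>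
     f1 P C1_differentiable_on UNIV \<and> f1 P 0 = 0 \<and> (\<forall>x. x \<noteq> 0 \<longrightarrow> 0 < x * f1 P x) \<and>
     f2 P C1_differentiable_on UNIV \<and> f2 P 0 = 0 \<and> (\<forall>x. x \<noteq> 0 \<longrightarrow> 0 < x * f2 P x)"

text \<open>
  The state \<open>w = (r, \<phi>, s, v)\<close>; the product Euclidean space plays the role of \<open>\<real>\<^sup>4\<^sup>n\<close>.
\<close>

type_synonym 'n state = "(real ^ 'n) \<times> (real ^ 'n) \<times> (real ^ 'n) \<times> (real ^ 'n)"

definition st_r :: "'n::finite state \<Rightarrow> 'n \<Rightarrow> real" where
  "st_r w i = fst w $ i"

definition st_phi :: "'n::finite state \<Rightarrow> 'n \<Rightarrow> real" where
  "st_phi w i = fst (snd w) $ i"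

definition st_s :: "'n::finite state \<Rightarrow> 'n \<Rightarrow> real" where
  "st_s w i = fst (snd (snd w)) $ i"

definition st_v :: "'n::finite state \<Rightarrow> 'n \<Rightarrow> real" where
  "st_v w i = snd (snd (snd w)) $ i"

definition vdist :: "'n::finite params \<Rightarrow> 'n state \<Rightarrow> 'n \<Rightarrow> 'n \<Rightarrow> real" where
  "vdist P w i j =
     sqrt (pcoef P i j * (st_r w i - st_r w j)\<^sup>2
           + 2 * st_r w i * st_r w j * (1 - cos (st_phi w i - st_phi w j)))"

definition Omega :: "'n::finite params \<Rightarrow> 'n state set" where
  "Omega P = {w.
     (\<forall>i. st_r w i \<in> {Rin P <..< Rout P} \<and>
          st_s w i \<in> {- Theta P <..< Theta P} \<and>
          st_v w i \<in> {0 <..< vmax P}) \<and>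
     (\<forall>i j. j \<noteq> i \<longrightarrow> vdist P w i j > Lmin P i j)}"

definition ang_speed :: "'n::finite state \<Rightarrow> 'n \<Rightarrow> real" where
  "ang_speed w i = st_v w i / st_r w i * cos (st_s w i)"

definition H_R :: "'n::finite params \<Rightarrow> 'n state \<Rightarrow> real" where
  "H_R P w =
     1/2 * (\<Sum>i\<in>UNIV. ((ang_speed w i - omega P)\<^sup>2
                      + bcoef P * (st_v w i)\<^sup>2 * (sin (st_s w i))\<^sup>2)
                     / ((vmax P - st_v w i) * st_v w i))
     + (\<Sum>i\<in>UNIV. Upot P i (st_r w i))
     + 1/2 * (\<Sum>i\<in>UNIV. \<Sum>j\<in>UNIV - {i}. Vpot P i j (vdist P w i j))
     + Acoef P * (\<Sum>i\<in>UNIV. 1 / (cos (st_s w i) - cos (Theta P)) - 1 / (1 - cos (Theta P)))"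

definition q_fun :: "'n params \<Rightarrow> real \<Rightarrow> real \<Rightarrow> real \<Rightarrow> real" where
  "q_fun P r s v =
     (vmax P * v * cos s - 2 * r * v * omega P + r * omega P * vmax P)
     / (2 * r * (vmax P - v)\<^sup>2 * v\<^sup>2)"

definition gamma_fun :: "'n params \<Rightarrow> real \<Rightarrow> real \<Rightarrow> real \<Rightarrow> real" where
  "gamma_fun P r s v =
     Acoef P / (cos s - cos (Theta P))\<^sup>2
     + v * cos s / (vmax P - v) * (bcoef P - 1 / r\<^sup>2)
     + omega P / (r * (vmax P - v))"

definition zeta_fun :: "'n params \<Rightarrow> real \<Rightarrow> real \<Rightarrow> real" where
  "zeta_fun P s v = bcoef P * vmax P * sin s / (2 * (vmax P - v)\<^sup>2 * v)"

definition Z_fun :: "'n::finite params \<Rightarrow> 'n state \<Rightarrow> 'n \<Rightarrow> real" where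
  "Z_fun P w i =
     (ang_speed w i - omega P) * (cos (st_s w i) / ((vmax P - st_v w i) * (st_r w i)\<^sup>2))
     - deriv (Upot P i) (st_r w i)
     - (\<Sum>j\<in>UNIV - {i}.
          (pcoef P i j * (st_r w i - st_r w j)
             + st_r w j * (1 - cos (st_phi w i - st_phi w j)))
          * (deriv (Vpot P i j) (vdist P w i j) / vdist P w i j))"

definition Phi_fun :: "'n::finite params \<Rightarrow> 'n state \<Rightarrow> 'n \<Rightarrow> real" where
  "Phi_fun P w i =
     st_r w i / omega P *
     (\<Sum>j\<in>UNIV - {i}. deriv (Vpot P i j) (vdist P w i j)
        * (st_r w j * sin (st_phi w i - st_phi w j) / vdist P w i j))"

definition G_fun :: "'n::finite params \<Rightarrow> 'n state \<Rightarrow> 'n \<Rightarrow> real" where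
  "G_fun P w i =
     1 / omega P *
     (\<Sum>j\<in>UNIV - {i}. kappa P i j (vdist P w i j)
        * (g1 P (ang_speed w j) - g1 P (ang_speed w i)))"

definition M_fun :: "'n::finite params \<Rightarrow> 'n state \<Rightarrow> 'n \<Rightarrow> real" where
  "M_fun P w i =
     (\<Sum>j\<in>UNIV - {i}. kappa P i j (vdist P w i j)
        * (g2 P (sin (st_s w j)) - g2 P (sin (st_s w i))))"

definition F_law :: "'n::finite params \<Rightarrow> 'n state \<Rightarrow> 'n \<Rightarrow> real" where
  "F_law P w i =
     - (1 / q_fun P (st_r w i) (st_s w i) (st_v w i)) *
     (f1 P (ang_speed w i - omega P) + omega P * (Phi_fun P w i - G_fun P w i))"

definition delta_law :: "'n::finite params \<Rightarrow> 'n state \<Rightarrow> 'n \<Rightarrow> real" where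
  "delta_law P w i =
     arctan (sigma P i / st_r w i * cos (st_s w i)
       - sigma P i / (gamma_fun P (st_r w i) (st_s w i) (st_v w i) * st_v w i) *
         (f2 P (sin (st_s w i))
          + (zeta_fun P (st_s w i) (st_v w i) * F_law P w i + Z_fun P w i) * st_v w i
          - M_fun P w i))"

text \<open>The vehicle model, with acceleration inputs \<open>F\<close> and steering inputs \<open>\<delta>\<close>.\<close>

definition vehicle_field ::
    "'n::finite params \<Rightarrow> ('n \<Rightarrow> real) \<Rightarrow> ('n \<Rightarrow> real) \<Rightarrow> 'n state \<Rightarrow> 'n state" where
  "vehicle_field P F \<delta> w =
     (\<chi> i. - st_v w i * sin (st_s w i),
      \<chi> i. st_v w i / st_r w i * cos (st_s w i),
      \<chi> i. st_v w i / sigma P i * tan (\<delta> i) - st_v w i / st_r w i * cos (st_s w i),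
      \<chi> i. F i)"

text \<open>
  Solutions on a time interval \<open>J\<close>.  The feedback laws are only meaningful on \<open>Omega P\<close>, so a
  solution lies in \<open>Omega P\<close>; derivatives at endpoints belonging to \<open>J\<close> are one-sided.
\<close>

definition solves_ivp ::
    "'n::finite params \<Rightarrow> 'n state \<Rightarrow> real set \<Rightarrow> (real \<Rightarrow> 'n state) \<Rightarrow> bool" where
  "solves_ivp P w0 J w \<longleftrightarrow>
     w 0 = w0 \<and>
     (\<forall>t\<in>J. w t \<in> Omega P \<and>
        (w has_vector_derivative vehicle_field P (F_law P (w t)) (delta_law P (w t)) (w t))
          (at t within J))"

end

theory Submission
  imports Defs
begin

text \<open>
The function \<^const>\<open>H_R\<close> is a barrier and a Lyapunov function at once.  Each of its summands is
nonnegative and one of them blows up at every part of the boundary of \<^const>\<open>Omega\<close>: the kinetic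
terms at speeds \<open>0\<close> and \<open>v\<^sub>m\<^sub>a\<^sub>x\<close>, the potentials at the road boundary and at the
minimal distances, the last term at headings \<open>\<plusminus>\<Theta>\<close>.  So its sublevel sets are closed in the
whole space and, up to adding full turns to the polar angles, compact.

Along the closed loop, write \<open>y\<^sub>i\<close> for the error of the angular speed.  The derivative of
\<open>H_R\<close> is a linear form in the velocity with coefficients built from \<open>q\<close>, \<open>\<zeta>\<close>, \<open>\<gamma>\<close>,
\<open>Z\<close> and \<open>\<Phi>\<close>, and the feedback laws are solved for \<open>q F\<close> and for \<open>\<gamma>\<close> times the heading
rate.  What remains is
\<open>- \<Sum>(y\<^sub>i f\<^sub>1(y\<^sub>i) + sin s\<^sub>i f\<^sub>2(sin s\<^sub>i)) + \<omega>\<^sup>2 \<Sum>\<Phi>\<^sub>i\<close> plus two consensus sums.  The sum of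
the \<open>\<Phi>\<^sub>i\<close> vanishes because the pair forces are opposite, and the consensus sums are nonpositive
because \<open>\<kappa>\<close> is symmetric and \<open>g\<^sub>1\<close>, \<open>g\<^sub>2\<close> are monotone (\<open>lyap_slope_cruise\<close>).

Global existence follows from a cut-off.  Multiplying the field by a function of \<open>H_R\<close> with values in
\<open>[0, 1]\<close> that is \<open>1\<close> on the initial sublevel set and \<open>0\<close> beyond a slightly larger one gives a
bounded globally Lipschitz field, for which a weighted fixed-point argument yields a solution on the
whole half-line (\<open>lipschitz_ode_exists\<close>).  The factor does not change the sign of the derivative of
\<open>H_R\<close>, so this solution never leaves the initial sublevel set and solves the original equation
(\<open>global_solution\<close>).  Every solution stays in that sublevel set, which gives uniqueness by
Gronwall's argument, and the bound on \<open>F\<close> by compactness (\<open>F_law_bound\<close>).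

For the limits, \<open>H_R\<close> converges along a solution while its derivative is at most the negative of each
dissipation term; these are uniformly continuous in time, so they tend to zero by Barbalat's lemma.
Hence \<open>y\<^sub>i\<close> and \<open>s\<^sub>i\<close> tend to zero, and a second application of the lemma shows that so do
their derivatives, from which \<open>F\<^sub>i\<close> is recovered.
\<close>

section \<open>Lipschitz continuity near a point\<close>

text \<open>
Local Lipschitz continuity is recorded point by point, so that the rules for quotients and square roots
need their side conditions only at the point itself.
\<close>

definition lipschitz_near :: "('a::metric_space \<Rightarrow> 'b::metric_space) \<Rightarrow> 'a \<Rightarrow> bool" where
  "lipschitz_near f x \<longleftrightarrow> (\<exists>e>0. \<exists>L. L-lipschitz_on (ball x e) f)"

lemma lipschitz_near_imp_isCont: "lipschitz_near f x \<Longrightarrow> isCont f x"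
  unfolding lipschitz_near_def
  by (metis centre_in_ball continuous_on_eq_continuous_at lipschitz_on_continuous_on open_ball)

lemma lipschitz_near_cong:
  assumes "lipschitz_near g x" "open S" "x \<in> S" "\<And>y. y \<in> S \<Longrightarrow> f y = g y"
  shows "lipschitz_near f x"
proof -
  obtain e L where e: "e > 0" "L-lipschitz_on (ball x e) g"
    using assms(1) unfolding lipschitz_near_def by blast
  obtain d where d: "d > 0" "ball x d \<subseteq> S"
    using assms(2,3) openE by blast
  have "L-lipschitz_on (ball x (min d e)) g"
    by (rule lipschitz_on_subset[OF e(2)]) auto
  moreover have "f y = g y" if "y \<in> ball x (min d e)" for y
    using that d assms(4) by auto
  ultimately have "L-lipschitz_on (ball x (min d e)) f"
    by (simp add: lipschitz_on_def)
  then show ?thesis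
    unfolding lipschitz_near_def using d e by (metis min_less_iff_conj)
qed

lemma lipschitz_near_compose:
  assumes f: "lipschitz_near f x" and g: "lipschitz_near g (f x)"
  shows "lipschitz_near (\<lambda>x. g (f x)) x"
proof -
  obtain e L where e: "e > 0" "L-lipschitz_on (ball x e) f"
    using f unfolding lipschitz_near_def by blast
  obtain d M where d: "d > 0" "M-lipschitz_on (ball (f x) d) g"
    using g unfolding lipschitz_near_def by blast
  obtain k where k: "k > 0" "\<And>y. dist y x < k \<Longrightarrow> dist (f y) (f x) < d"
    using lipschitz_near_imp_isCont[OF f] d(1) unfolding continuous_at_eps_delta by blast
  have "(M * L)-lipschitz_on (ball x (min e k)) (\<lambda>x. g (f x))"
  proof (rule lipschitz_on_compose2[where f=f and g=g])
    show "L-lipschitz_on (ball x (min e k)) f"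
      by (rule lipschitz_on_subset[OF e(2)]) auto
    show "M-lipschitz_on (f ` ball x (min e k)) g"
      by (rule lipschitz_on_subset[OF d(2)]) (use k(2) in \<open>auto simp: dist_commute\<close>)
  qed
  then show ?thesis
    unfolding lipschitz_near_def using e k by (metis min_less_iff_conj)
qed

lemma lipschitz_near_both:
  assumes "lipschitz_near f x" "lipschitz_near g x"
  obtains e L M where "e > 0" "L-lipschitz_on (ball x e) f" "M-lipschitz_on (ball x e) g"
proof -
  obtain e L where e: "e > 0" "L-lipschitz_on (ball x e) f"
    using assms unfolding lipschitz_near_def by blast
  obtain d M where d: "d > 0" "M-lipschitz_on (ball x d) g"
    using assms unfolding lipschitz_near_def by blast
  show ?thesis
    by (rule that[of "min d e" L M])
      (use e d in \<open>auto intro: lipschitz_on_subset\<close>)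
qed

named_theorems lipschitz_near_intros

lemma lipschitz_near_const [lipschitz_near_intros]: "lipschitz_near (\<lambda>x. c) x"
  unfolding lipschitz_near_def using lipschitz_on_constant zero_less_one by blast

lemma lipschitz_near_bounded_linear:
  assumes "bounded_linear f" shows "lipschitz_near f x"
  unfolding lipschitz_near_def
  using bounded_linear.lipschitz_boundE[OF assms] zero_less_one by metis

lemma lipschitz_near_add [lipschitz_near_intros]:
  fixes f g :: "'a::metric_space \<Rightarrow> 'b::real_normed_vector"
  assumes "lipschitz_near f x" "lipschitz_near g x"
  shows "lipschitz_near (\<lambda>x. f x + g x) x"
  using lipschitz_near_both[OF assms] lipschitz_on_add unfolding lipschitz_near_def by metis

lemma lipschitz_near_minus [lipschitz_near_intros]:
  fixes f :: "'a::metric_space \<Rightarrow> 'b::real_normed_vector"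
  shows "lipschitz_near f x \<Longrightarrow> lipschitz_near (\<lambda>x. - f x) x"
  unfolding lipschitz_near_def by simp

lemma lipschitz_near_diff [lipschitz_near_intros]:
  fixes f g :: "'a::metric_space \<Rightarrow> 'b::real_normed_vector"
  assumes "lipschitz_near f x" "lipschitz_near g x"
  shows "lipschitz_near (\<lambda>x. f x - g x) x"
  using lipschitz_near_add[OF assms(1) lipschitz_near_minus[OF assms(2)]] by simp

lemma lipschitz_near_sum [lipschitz_near_intros]:
  fixes f :: "'i \<Rightarrow> 'a::metric_space \<Rightarrow> 'b::real_normed_vector"
  assumes "\<And>i. i \<in> I \<Longrightarrow> lipschitz_near (f i) x"
  shows "lipschitz_near (\<lambda>x. \<Sum>i\<in>I. f i x) x"
  using assms
  by (induction I rule: infinite_finite_induct) (auto intro: lipschitz_near_intros)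

lemma lipschitz_near_Pair [lipschitz_near_intros]:
  assumes "lipschitz_near f x" "lipschitz_near g x"
  shows "lipschitz_near (\<lambda>x. (f x, g x)) x"
  using lipschitz_near_both[OF assms] lipschitz_on_Pair unfolding lipschitz_near_def by metis

text \<open>
On a small ball both factors are bounded, by their value at the centre plus Lipschitz constant times
radius, and the product rule for differences applies.
\<close>

lemma lipschitz_near_scaleR [lipschitz_near_intros]:
  fixes f :: "'a::metric_space \<Rightarrow> real" and g :: "'a \<Rightarrow> 'b::real_normed_vector"
  assumes "lipschitz_near f x" "lipschitz_near g x"
  shows "lipschitz_near (\<lambda>x. f x *\<^sub>R g x) x"
proof -
  obtain e L M where e: "e > 0" and L: "L-lipschitz_on (ball x e) f"
    and M: "M-lipschitz_on (ball x e) g"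
    using lipschitz_near_both[OF assms] .
  define A where "A = \<bar>f x\<bar> + L * e"
  define B where "B = norm (g x) + M * e"
  have L0: "0 \<le> L" "0 \<le> M" using L M lipschitz_on_nonneg by blast+
  have fA: "\<bar>f y\<bar> \<le> A" if "y \<in> ball x e" for y
  proof -
    have "dist (f y) (f x) \<le> L * dist y x"
      by (rule lipschitz_onD[OF L]) (use that e in auto)
    also have "\<dots> \<le> L * e" using that L0 by (intro mult_left_mono) (auto simp: dist_commute)
    finally show ?thesis unfolding A_def dist_real_def by linarith
  qed
  have gB: "norm (g y) \<le> B" if "y \<in> ball x e" for y
  proof -
    have "dist (g y) (g x) \<le> M * dist y x"
      by (rule lipschitz_onD[OF M]) (use that e in auto)
    also have "\<dots> \<le> M * e" using that L0 by (intro mult_left_mono) (auto simp: dist_commute)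
    finally show ?thesis unfolding B_def dist_norm using norm_triangle_sub[of "g y" "g x"] by linarith
  qed
  have "(A * M + L * B)-lipschitz_on (ball x e) (\<lambda>x. f x *\<^sub>R g x)"
  proof (rule lipschitz_onI)
    show "0 \<le> A * M + L * B" unfolding A_def B_def using L0 e by auto
    fix y z assume y: "y \<in> ball x e" and z: "z \<in> ball x e"
    have "f y *\<^sub>R g y - f z *\<^sub>R g z = f y *\<^sub>R (g y - g z) + (f y - f z) *\<^sub>R g z"
      by (simp add: algebra_simps)
    then have "dist (f y *\<^sub>R g y) (f z *\<^sub>R g z) \<le> \<bar>f y\<bar> * dist (g y) (g z) + dist (f y) (f z) * norm (g z)"
      unfolding dist_norm by (metis norm_scaleR norm_triangle_ineq real_norm_def)
    also have "\<dots> \<le> A * (M * dist y z) + (L * dist y z) * B"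
      using fA[OF y] gB[OF z] lipschitz_onD[OF L y z] lipschitz_onD[OF M y z] L0
      by (intro add_mono mult_mono) auto
    finally show "dist (f y *\<^sub>R g y) (f z *\<^sub>R g z) \<le> (A * M + L * B) * dist y z"
      by (simp add: algebra_simps)
  qed
  then show ?thesis unfolding lipschitz_near_def using e by blast
qed

lemma lipschitz_near_mult [lipschitz_near_intros]:
  fixes f g :: "'a::metric_space \<Rightarrow> real"
  assumes "lipschitz_near f x" "lipschitz_near g x"
  shows "lipschitz_near (\<lambda>x. f x * g x) x"
  using lipschitz_near_scaleR[OF assms] by simp

lemma lipschitz_near_power [lipschitz_near_intros]:
  fixes f :: "'a::metric_space \<Rightarrow> real"
  assumes "lipschitz_near f x"
  shows "lipschitz_near (\<lambda>x. f x ^ n) x"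
  by (induction n) (auto intro!: lipschitz_near_intros assms)

lemma lipschitz_near_vec [lipschitz_near_intros]:
  fixes f :: "'i::finite \<Rightarrow> 'a::metric_space \<Rightarrow> real"
  assumes "\<And>i. lipschitz_near (f i) x"
  shows "lipschitz_near (\<lambda>x. \<chi> i. f i x) x"
proof -
  have eq: "(\<chi> i. f i y) = (\<Sum>i\<in>UNIV. f i y *\<^sub>R axis i 1)" for y
    by (simp add: vec_eq_iff axis_def if_distrib[where f="\<lambda>a. _ * a"] cong: if_cong)
  show ?thesis unfolding eq by (intro lipschitz_near_intros assms)
qed

text \<open>
The derivative is bounded on a small closed ball, and balls are convex.
\<close>

lemma lipschitz_near_C1:
  fixes f :: "real \<Rightarrow> real"
  assumes "f C1_differentiable_on S" "open S" "x \<in> S"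
  shows "lipschitz_near f x"
proof -
  obtain D where D: "\<And>x. x \<in> S \<Longrightarrow> (f has_vector_derivative D x) (at x)" and cD: "continuous_on S D"
    using assms(1) unfolding C1_differentiable_on_def by blast
  obtain e where e: "e > 0" "cball x e \<subseteq> S" using assms open_contains_cball by blast
  have "bounded (D ` cball x e)"
    by (intro compact_imp_bounded compact_continuous_image continuous_on_subset[OF cD]) (use e in auto)
  then obtain B where B: "\<And>y. y \<in> cball x e \<Longrightarrow> norm (D y) \<le> B"
    unfolding bounded_iff by blast
  have "B-lipschitz_on (cball x e) f"
  proof (rule bounded_derivative_imp_lipschitz)
    show "(f has_derivative (\<lambda>h. h *\<^sub>R D y)) (at y within cball x e)" if "y \<in> cball x e" for y
      using D[of y] that e unfolding has_vector_derivative_def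
      by (blast intro: has_derivative_at_withinI)
    show "onorm (\<lambda>h. h *\<^sub>R D y) \<le> B" if "y \<in> cball x e" for y
      using B[OF that] 
      by (intro onorm_le) (simp add: abs_mult mult.commute[of B] mult_left_mono)
    show "0 \<le> B" using B[of x] e norm_ge_zero by (metis centre_in_cball less_eq_real_def order_trans)
  qed auto
  then show ?thesis unfolding lipschitz_near_def using e
    by (meson ball_subset_cball lipschitz_on_subset)
qed

lemma C1_differentiable_onI_real:
  fixes f :: "real \<Rightarrow> real"
  assumes "\<And>x. x \<in> S \<Longrightarrow> (f has_real_derivative D x) (at x)" "continuous_on S D"
  shows "f C1_differentiable_on S"
  using assms unfolding C1_differentiable_on_def has_real_derivative_iff_has_vector_derivative by blast

lemma C1_differentiable_on_has_deriv:
  assumes "f C1_differentiable_on S" "open S" "x \<in> S"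
  shows "(f has_real_derivative deriv f x) (at x)"
  using assms by (simp add: C1_differentiable_on_eq DERIV_deriv_iff_real_differentiable)

lemma lipschitz_near_inverse [lipschitz_near_intros]:
  fixes f :: "'a::metric_space \<Rightarrow> real"
  assumes "lipschitz_near f x" "f x \<noteq> 0"
  shows "lipschitz_near (\<lambda>x. inverse (f x)) x"
proof (rule lipschitz_near_compose[OF assms(1)])
  have "inverse C1_differentiable_on (- {0::real})"
    by (rule C1_differentiable_onI_real[where D="\<lambda>x. - (inverse x * inverse x)"])
       (auto intro!: DERIV_inverse' derivative_eq_intros continuous_intros)
  then show "lipschitz_near inverse (f x)"
    by (rule lipschitz_near_C1) (use assms in auto)
qed

lemma lipschitz_near_divide [lipschitz_near_intros]:
  fixes f g :: "'a::metric_space \<Rightarrow> real"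
  assumes "lipschitz_near f x" "lipschitz_near g x" "g x \<noteq> 0"
  shows "lipschitz_near (\<lambda>x. f x / g x) x"
  unfolding divide_inverse by (intro lipschitz_near_intros assms)

lemma lipschitz_near_sin [lipschitz_near_intros]:
  fixes f :: "'a::metric_space \<Rightarrow> real"
  assumes "lipschitz_near f x"
  shows "lipschitz_near (\<lambda>x. sin (f x)) x"
  by (rule lipschitz_near_compose[OF assms], rule lipschitz_near_C1[where S=UNIV],
      rule C1_differentiable_onI_real[where D=cos]) (auto intro!: derivative_eq_intros continuous_intros)

lemma lipschitz_near_cos [lipschitz_near_intros]:
  fixes f :: "'a::metric_space \<Rightarrow> real"
  assumes "lipschitz_near f x"
  shows "lipschitz_near (\<lambda>x. cos (f x)) x"
  by (rule lipschitz_near_compose[OF assms], rule lipschitz_near_C1[where S=UNIV],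
      rule C1_differentiable_onI_real[where D="\<lambda>x. - sin x"]) (auto intro!: derivative_eq_intros continuous_intros)

lemma lipschitz_near_sqrt [lipschitz_near_intros]:
  fixes f :: "'a::metric_space \<Rightarrow> real"
  assumes "lipschitz_near f x" "f x > 0"
  shows "lipschitz_near (\<lambda>x. sqrt (f x)) x"
  by (rule lipschitz_near_compose[OF assms(1)], rule lipschitz_near_C1[where S="{0<..}"],
      rule C1_differentiable_onI_real[where D="\<lambda>x. inverse (sqrt x) / 2"])
     (use assms in \<open>auto intro!: derivative_eq_intros continuous_intros\<close>)

text \<open>
A function that is Lipschitz near each point of a compact set \<open>C\<close> has Lipschitz constants and radii
that are uniform on everything that its periods move into \<open>C\<close>.  Otherwise pairs of points at distances
tending to zero, with first point in \<open>C\<close>, would violate the estimate with constants tending to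
infinity; the first points accumulate at some point of \<open>C\<close>, and this contradicts the assumption there.
The second point of a pair is free, which is what lets the estimate reach across the boundary of \<open>K\<close>.
\<close>

lemma periodic_lipschitz_uniform:
  fixes f :: "'a::real_normed_vector \<Rightarrow> 'b::metric_space"
  assumes C: "compact C"
    and per: "\<And>x. x \<in> K \<Longrightarrow> \<exists>g. x + g \<in> C \<and> (\<forall>y. f (y + g) = f y)"
    and lip: "\<And>x. x \<in> C \<Longrightarrow> lipschitz_near f x"
  shows "\<exists>d>0. \<exists>L\<ge>0. \<forall>x\<in>K. \<forall>y. dist x y < d \<longrightarrow> dist (f x) (f y) \<le> L * dist x y"
proof -
  have "\<exists>d>0. \<exists>L\<ge>0. \<forall>x\<in>C. \<forall>y. dist x y < d \<longrightarrow> dist (f x) (f y) \<le> L * dist x y"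
  proof (rule ccontr)
    assume neg: "\<not> ?thesis"
    have "\<exists>x\<in>C. \<exists>y. dist x y < inverse (Suc n) \<and> dist (f x) (f y) > real n * dist x y" for n :: nat
    proof -
      have "(0::real) < inverse (Suc n)" "(0::real) \<le> real n" by auto
      then show ?thesis using neg by (meson not_le)
    qed
    then obtain X Y where X: "\<And>n. X n \<in> C"
      and XY: "\<And>n::nat. dist (X n) (Y n) < inverse (Suc n)"
      and f: "\<And>n. dist (f (X n)) (f (Y n)) > real n * dist (X n) (Y n)"
      by metis
    obtain x r where x: "x \<in> C" and r: "strict_mono r" and lim: "(X \<circ> r) \<longlonglongrightarrow> x"
      using C X unfolding compact_def by metis
    obtain e L where e: "e > 0" and L: "L-lipschitz_on (ball x e) f"
      using lip[OF x] unfolding lipschitz_near_def by blast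
    have "(\<lambda>n. inverse (real (Suc (r n)))) \<longlonglongrightarrow> 0"
      using LIMSEQ_subseq_LIMSEQ[OF LIMSEQ_inverse_real_of_nat r] by (simp add: o_def)
    then have "eventually (\<lambda>n. inverse (real (Suc (r n))) < e / 2) sequentially"
      using e by (intro order_tendstoD) auto
    moreover have "eventually (\<lambda>n. dist (X (r n)) x < e / 2) sequentially"
      using tendstoD[OF lim, of "e/2"] e by simp
    moreover have "eventually (\<lambda>n. n > L) sequentially"
      using eventually_gt_at_top[of "nat \<lceil>L\<rceil>"] by eventually_elim linarith
    ultimately have "eventually (\<lambda>n::nat. False) sequentially"
    proof eventually_elim
      case (elim n)
      have 1: "X (r n) \<in> ball x e" using elim e by (simp add: dist_commute)
      have "dist x (Y (r n)) \<le> dist (X (r n)) x + dist (X (r n)) (Y (r n))"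
        by (rule dist_triangle3)
      then have 2: "Y (r n) \<in> ball x e" using elim XY[of "r n"] by simp
      have "n \<le> r n" using r by (rule seq_suble)
      then have "L * dist (X (r n)) (Y (r n)) \<le> real (r n) * dist (X (r n)) (Y (r n))"
        using elim by (intro mult_right_mono) auto
      then show False using lipschitz_onD[OF L 1 2] f[of "r n"] by linarith
    qed
    then show False by simp
  qed
  then obtain d L where d: "d > 0" "L \<ge> 0"
    and L: "\<And>x y. x \<in> C \<Longrightarrow> dist x y < d \<Longrightarrow> dist (f x) (f y) \<le> L * dist x y"
    by blast
  have "dist (f x) (f y) \<le> L * dist x y" if x: "x \<in> K" and y: "dist x y < d" for x y
  proof -
    obtain g where g: "x + g \<in> C" "\<And>y. f (y + g) = f y" using per[OF x] by blast
    show ?thesis using L[OF g(1), of "y + g"] y by (simp add: g(2))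
  qed
  then show ?thesis using d by blast
qed

lemma periodic_bounded:
  fixes f :: "'a::real_normed_vector \<Rightarrow> 'b::metric_space"
  assumes C: "compact C"
    and per: "\<And>x. x \<in> K \<Longrightarrow> \<exists>g. x + g \<in> C \<and> (\<forall>y. f (y + g) = f y)"
    and lip: "\<And>x. x \<in> C \<Longrightarrow> lipschitz_near f x"
  shows "bounded (f ` K)"
proof (rule bounded_subset)
  show "bounded (f ` C)"
    by (intro compact_imp_bounded compact_continuous_image C continuous_at_imp_continuous_on ballI
        lipschitz_near_imp_isCont lip)
  show "f ` K \<subseteq> f ` C" using per by (metis image_iff image_subsetI)
qed

section \<open>Differential equations with a globally Lipschitz field\<close>

lemma derivative_le_imp_increment_le:
  fixes h :: "real \<Rightarrow> real"
  assumes "a \<le> b"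
    and "\<And>t. t \<in> {a..b} \<Longrightarrow> (h has_real_derivative h' t) (at t within {a..b})"
    and "\<And>t. t \<in> {a..b} \<Longrightarrow> h' t \<le> m"
  shows "h b \<le> h a + m * (b - a)"
proof -
  obtain t where "t \<in> {a..b}" "h b - h a = h' t * (b - a)"
    using mvt_very_simple[OF assms(1), where f=h and f'="\<lambda>t x. h' t * x"] assms(2)
    unfolding has_field_derivative_def by auto
  then show ?thesis using assms(1) assms(3)[of t] mult_right_mono[of "h' t" m "b - a"] by auto
qed

text \<open>
Gronwall's argument: the squared distance of two solutions, discounted by \<open>exp (- 2 L t)\<close>, does not
increase.
\<close>

lemma lipschitz_ode_unique:
  fixes x y :: "real \<Rightarrow> 'a::real_inner"
  assumes L: "L-lipschitz_on S f"
    and x: "\<And>t. t \<in> {0..T} \<Longrightarrow> x t \<in> S"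
      "\<And>t. t \<in> {0..T} \<Longrightarrow> (x has_vector_derivative f (x t)) (at t within {0..T})"
    and y: "\<And>t. t \<in> {0..T} \<Longrightarrow> y t \<in> S"
      "\<And>t. t \<in> {0..T} \<Longrightarrow> (y has_vector_derivative f (y t)) (at t within {0..T})"
    and "x 0 = y 0" and T: "0 \<le> T"
  shows "x T = y T"
proof -
  define D where "D t = exp (- 2 * L * t) * ((x t - y t) \<bullet> (x t - y t))" for t
  define D' where "D' t = exp (- 2 * L * t) * (2 * ((f (x t) - f (y t)) \<bullet> (x t - y t)))
      - 2 * L * exp (- 2 * L * t) * ((x t - y t) \<bullet> (x t - y t))" for t
  have "D T \<le> D 0 + 0 * (T - 0)"
  proof (rule derivative_le_imp_increment_le[OF T, where h'=D'])
    fix t assume t: "t \<in> {0..T}"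
    have d: "((\<lambda>t. x t - y t) has_vector_derivative f (x t) - f (y t)) (at t within {0..T})"
      by (intro has_vector_derivative_diff x y t)
    have "((\<lambda>t. (x t - y t) \<bullet> (x t - y t)) has_vector_derivative
        ((x t - y t) \<bullet> (f (x t) - f (y t)) + (f (x t) - f (y t)) \<bullet> (x t - y t))) (at t within {0..T})"
      by (rule bounded_bilinear.has_vector_derivative[OF bounded_bilinear_inner d d])
    then have e: "((\<lambda>t. (x t - y t) \<bullet> (x t - y t)) has_real_derivative
        (2 * ((f (x t) - f (y t)) \<bullet> (x t - y t)))) (at t within {0..T})"
      unfolding has_real_derivative_iff_has_vector_derivative by (simp add: inner_commute)
    show "(D has_real_derivative D' t) (at t within {0..T})"
      unfolding D_def D'_def by (auto intro!: derivative_eq_intros e)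
    have "(f (x t) - f (y t)) \<bullet> (x t - y t) \<le> norm (f (x t) - f (y t)) * norm (x t - y t)"
      by (rule norm_cauchy_schwarz)
    also have "\<dots> \<le> (L * norm (x t - y t)) * norm (x t - y t)"
      using lipschitz_onD[OF L x(1)[OF t] y(1)[OF t]] by (intro mult_right_mono) (auto simp: dist_norm)
    also have "\<dots> = L * ((x t - y t) \<bullet> (x t - y t))"
      by (simp add: power2_norm_eq_inner[symmetric] power2_eq_square)
    finally have "(f (x t) - f (y t)) \<bullet> (x t - y t) \<le> L * ((x t - y t) \<bullet> (x t - y t))" .
    then have "exp (- 2 * L * t) * (2 * ((f (x t) - f (y t)) \<bullet> (x t - y t)))
        \<le> exp (- 2 * L * t) * (2 * (L * ((x t - y t) \<bullet> (x t - y t))))"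
      by (intro mult_left_mono) auto
    then show "D' t \<le> 0" unfolding D'_def by (simp add: mult_ac)
  qed
  then have "(x T - y T) \<bullet> (x T - y T) \<le> 0"
    unfolding D_def using assms by (simp add: mult_le_0_iff)
  then show ?thesis by (metis inner_eq_zero_iff inner_ge_zero order_antisym right_minus_eq)
qed

lemma integral_derivative_halfline:
  fixes g :: "real \<Rightarrow> 'a::banach"
  assumes g: "continuous_on UNIV g" and t: "t \<ge> 0"
  shows "((\<lambda>u. integral {0..u} g) has_vector_derivative g t) (at t within {0..})"
proof -
  have "((\<lambda>u. integral {0..u} g) has_vector_derivative g t) (at t within {0..t+1})"
    by (rule integral_has_vector_derivative) (use t in \<open>auto intro: continuous_on_subset[OF g]\<close>)
  moreover have "at t within {0..t+1} = at t within {0..}"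
    by (rule at_within_nhd[of _ "{..<t+1}"]) auto
  ultimately show ?thesis by simp
qed

text \<open>
In the unknown \<open>z t = exp (- m t) (x t - x0)\<close> the Picard operator is a contraction on the bounded
continuous functions of the whole line once \<open>m\<close> exceeds twice the Lipschitz constant, so that a
solution on the whole half-line comes from one application of Banach's theorem, without glueing
local solutions.  Boundedness of \<open>f\<close> keeps the operator inside the bounded functions.
\<close>

lemma lipschitz_ode_exists:
  fixes f :: "'a::banach \<Rightarrow> 'a"
  assumes f: "L-lipschitz_on UNIV f" and b: "bounded (range f)"
  shows "\<exists>x. x 0 = x0 \<and> (\<forall>t\<ge>0. (x has_vector_derivative f (x t)) (at t within {0..}))"
proof -
  obtain M where M: "\<And>x. norm (f x) \<le> M" using b unfolding bounded_iff by blast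
  have M0: "0 \<le> M" using M[of 0] norm_ge_zero order_trans by blast
  have L0: "0 \<le> L" using f by (rule lipschitz_on_nonneg)
  \<comment> \<open>the additional 1 keeps the weight positive when \<open>f\<close> is constant\<close>
  define m where "m = 2 * (L + 1)"
  have m: "m > 0" using L0 by (simp add: m_def)
  have cf: "continuous_on UNIV f" using f by (rule lipschitz_on_continuous_on)
  define g where "g z s = f (x0 + exp (m * s) *\<^sub>R apply_bcontfun z s)" for z :: "real \<Rightarrow>\<^sub>C 'a" and s
  have cg: "continuous_on S (g z)" for z S
    unfolding g_def
    by (rule continuous_on_compose2[OF cf]) (auto intro!: continuous_intros)
  have ig: "g z integrable_on {0..u}" for z u
    by (intro integrable_continuous_real cg)
  define I where "I z u = integral {0..u} (g z)" for z u
  have I_der: "(I z has_vector_derivative g z t) (at t within {0..})" if "t \<ge> 0" for z t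
    unfolding I_def by (rule integral_derivative_halfline[OF cg that])
  have cI: "continuous_on {0..} (I z)" for z
    using I_der by (meson atLeast_iff continuous_on_eq_continuous_within has_vector_derivative_continuous)
  have nI: "norm (I z u) \<le> M * u" if "u \<ge> 0" for z u
    using integral_bound[OF that cg, of z M] M that by (simp add: I_def g_def)
  \<comment> \<open>constant continuation to negative times, where the equation imposes nothing\<close>
  define T where "T z = Bcontfun (\<lambda>t. exp (- m * max 0 t) *\<^sub>R I z (max 0 t))" for z
  have T_in: "(\<lambda>t. exp (- m * max 0 t) *\<^sub>R I z (max 0 t)) \<in> bcontfun" for z
  proof (rule bcontfun_normI)
    have "continuous_on UNIV (\<lambda>t. I z (max 0 t))"
      by (rule continuous_on_compose2[OF cI]) (auto intro!: continuous_intros)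
    then show "continuous_on UNIV (\<lambda>t. exp (- m * max 0 t) *\<^sub>R I z (max 0 t))"
      by (intro continuous_intros)
    fix t :: real
    define u where "u = max 0 t"
    have u: "u \<ge> 0" by (simp add: u_def)
    have "m * u \<le> exp (m * u)" using exp_ge_add_one_self[of "m*u"] by linarith
    then have "exp (- m * u) * (m * u) \<le> 1" by (simp add: exp_minus field_simps)
    then have "exp (- m * u) * u \<le> 1 / m" using m by (simp add: field_simps)
    moreover have "norm (exp (- m * u) *\<^sub>R I z u) \<le> exp (- m * u) * (M * u)"
      using nI[OF u] by simp
    ultimately show "norm (exp (- m * max 0 t) *\<^sub>R I z (max 0 t)) \<le> M * (1 / m)"
      unfolding u_def[symmetric]
      using mult_left_mono[of "exp (- m * u) * u" "1/m" M] M0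
      by (metis (no_types, opaque_lifting) mult.left_commute order_trans)
  qed
  have T_app: "apply_bcontfun (T z) t = exp (- m * max 0 t) *\<^sub>R I z (max 0 t)" for z t
    unfolding T_def using T_in by (simp add: Bcontfun_inverse)
  have "dist (T z) (T z') \<le> 1/2 * dist z z'" for z z'
  proof (rule dist_bound)
    fix t :: real
    define u where "u = max 0 t"
    have u: "u \<ge> 0" by (simp add: u_def)
    define D where "D = dist z z'"
    have D: "D \<ge> 0" by (simp add: D_def)
    have "((\<lambda>s. L * D * exp (m * s)) has_integral (L * D * exp (m * u) / m - L * D * exp (m * 0) / m)) {0..u}"
      by (rule fundamental_theorem_of_calculus[OF u])
        (use m in \<open>auto intro!: derivative_eq_intros
            simp: has_real_derivative_iff_has_vector_derivative[symmetric]\<close>)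
    then have hi: "((\<lambda>s. L * D * exp (m * s)) has_integral (L * D * (exp (m * u) - 1) / m)) {0..u}"
      by (simp add: algebra_simps diff_divide_distrib)
    have "norm (integral {0..u} (\<lambda>s. g z s - g z' s)) \<le> integral {0..u} (\<lambda>s. L * D * exp (m * s))"
    proof (rule integral_norm_bound_integral)
      show "(\<lambda>s. g z s - g z' s) integrable_on {0..u}" by (intro integrable_diff ig)
      show "(\<lambda>s. L * D * exp (m * s)) integrable_on {0..u}" using hi by blast
      fix s assume "s \<in> {0..u}"
      have "norm (g z s - g z' s) \<le> L * dist (x0 + exp (m * s) *\<^sub>R apply_bcontfun z s)
          (x0 + exp (m * s) *\<^sub>R apply_bcontfun z' s)"
        unfolding g_def dist_norm[symmetric] by (rule lipschitz_onD[OF f]) auto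
      also have "\<dots> = L * (exp (m * s) * dist (apply_bcontfun z s) (apply_bcontfun z' s))"
        by (simp add: dist_norm scaleR_diff_right[symmetric])
      also have "\<dots> \<le> L * (exp (m * s) * D)"
        unfolding D_def using L0 dist_bounded by (intro mult_left_mono) auto
      finally show "norm (g z s - g z' s) \<le> L * D * exp (m * s)" by (simp add: algebra_simps)
    qed
    also have "\<dots> = L * D * (exp (m * u) - 1) / m" using hi by blast
    finally have "norm (I z u - I z' u) \<le> L * D * (exp (m * u) - 1) / m"
      unfolding I_def by (simp add: integral_diff[OF ig ig])
    also have "\<dots> \<le> (m / 2) * D * exp (m * u) / m"
      using D L0 m u by (intro divide_right_mono mult_mono) (auto simp: m_def[symmetric], simp add: m_def)
    also have "\<dots> = D / 2 * exp (m * u)" using m by simp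
    finally have le: "norm (I z u - I z' u) \<le> D / 2 * exp (m * u)" .
    have "dist (T z t) (T z' t) = exp (- m * u) * norm (I z u - I z' u)"
      unfolding T_app u_def[symmetric] by (simp add: dist_norm scaleR_diff_right[symmetric])
    also have "\<dots> \<le> exp (- m * u) * (D / 2 * exp (m * u))"
      by (intro mult_left_mono le) auto
    also have "\<dots> = D / 2" by (simp add: exp_minus)
    finally show "dist (T z t) (T z' t) \<le> 1/2 * dist z z'" by (simp add: D_def)
  qed
  then obtain z where z: "T z = z"
    using banach_fix_type[of "1/2" T] by auto
  define x where "x t = x0 + I z t" for t
  have gz: "g z t = f (x t)" if "t \<ge> 0" for t
  proof -
    have "apply_bcontfun z t = exp (- m * t) *\<^sub>R I z t"
      using T_app[of z t] that by (simp add: z max_def)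
    then have "exp (m * t) *\<^sub>R apply_bcontfun z t = I z t"
      by (simp add: exp_minus)
    then show ?thesis by (simp add: g_def x_def)
  qed
  show ?thesis
  proof (intro exI conjI allI impI)
    show "x 0 = x0" by (simp add: x_def I_def)
    fix t :: real assume t: "0 \<le> t"
    show "(x has_vector_derivative f (x t)) (at t within {0..})"
      using I_der[OF t, of z] unfolding gz[OF t] x_def
      by (auto intro!: derivative_eq_intros)
  qed
qed

section \<open>Convergence to zero along trajectories\<close>

text \<open>
If \<open>u t \<ge> e\<close> at a late time, then \<open>u\<close> stays above \<open>e / 2\<close> for a time span that does not depend on
\<open>t\<close>, and \<open>h\<close> falls by a fixed amount during it; that is impossible once \<open>h\<close> is close to its limit.
The one-sided form serves both for dissipation inequalities and for derivatives.
\<close>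

lemma barbalat:
  fixes h h' u :: "real \<Rightarrow> real"
  assumes lim: "(h \<longlongrightarrow> l) at_top"
    and der: "\<And>t. t \<ge> 0 \<Longrightarrow> (h has_real_derivative h' t) (at t within {0..})"
    and le: "\<And>t. t \<ge> 0 \<Longrightarrow> h' t \<le> - u t"
    and uc: "uniformly_continuous_on {0..} u"
    and e: "e > 0"
  shows "eventually (\<lambda>t. u t < e) at_top"
proof -
  obtain d where d: "d > 0" "\<And>s t. 0 \<le> s \<Longrightarrow> 0 \<le> t \<Longrightarrow> dist s t < d \<Longrightarrow> dist (u s) (u t) < e / 2"
    using uc e unfolding uniformly_continuous_on_def by (metis atLeast_iff half_gt_zero)
  define k where "k = d / 2"
  have k: "k > 0" "k < d" using d by (auto simp: k_def)
  have "eventually (\<lambda>t. dist (h t) l < e * k / 4) at_top"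
    using e k by (intro tendstoD[OF lim]) auto
  then obtain T where T: "\<And>t. t \<ge> T \<Longrightarrow> dist (h t) l < e * k / 4"
    unfolding eventually_at_top_linorder by blast
  show ?thesis
    unfolding eventually_at_top_linorder
  proof (intro exI allI impI)
    fix t assume t: "max 0 T \<le> t"
    show "u t < e"
    proof (rule ccontr)
      assume "\<not> u t < e"
      have "h (t + k) \<le> h t + (- (e / 2)) * (t + k - t)"
      proof (rule derivative_le_imp_increment_le[where h'=h'])
        fix s assume s: "s \<in> {t..t+k}"
        then show "(h has_real_derivative h' s) (at s within {t..t+k})"
          using t by (intro DERIV_subset[OF der]) auto
        have "dist (u s) (u t) < e / 2" using s t k by (intro d) (auto simp: dist_real_def)
        then show "h' s \<le> - (e / 2)"
          using \<open>\<not> u t < e\<close> le[of s] s t unfolding dist_real_def by (auto simp: abs_if split: if_splits)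
      qed (use k in auto)
      moreover have "dist (h t) l < e * k / 4" "dist (h (t + k)) l < e * k / 4"
        using T t k by auto
      ultimately show False unfolding dist_real_def by (auto simp: abs_if algebra_simps split: if_splits)
    qed
  qed
qed

lemma derivative_tendsto_zero:
  fixes h h' :: "real \<Rightarrow> real"
  assumes lim: "(h \<longlongrightarrow> l) at_top"
    and der: "\<And>t. t \<ge> 0 \<Longrightarrow> (h has_real_derivative h' t) (at t within {0..})"
    and uc: "uniformly_continuous_on {0..} h'"
  shows "(h' \<longlongrightarrow> 0) at_top"
proof (rule tendstoI)
  fix e :: real assume e: "e > 0"
  have "eventually (\<lambda>t. h' t < e) at_top"
    by (rule barbalat[where h="\<lambda>t. - h t" and h'="\<lambda>t. - h' t" and l="- l"])
      (auto intro!: tendsto_minus lim DERIV_minus der uc e)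
  moreover have "eventually (\<lambda>t. - h' t < e) at_top"
    by (rule barbalat[where h=h and h'=h' and l=l])
      (auto intro!: lim der uniformly_continuous_on_minus uc e)
  ultimately show "eventually (\<lambda>t. dist (h' t) 0 < e) at_top"
    by eventually_elim (auto simp: abs_less_iff)
qed

text \<open>
Where \<open>e \<le> \<bar>x\<bar> \<le> B\<close>, the function \<open>\<phi>\<close> has a positive minimum.
\<close>

lemma tendsto_zero_of_positive_definite:
  fixes \<phi> u :: "real \<Rightarrow> real"
  assumes cont: "continuous_on UNIV \<phi>" and pos: "\<And>x. x \<noteq> 0 \<Longrightarrow> 0 < \<phi> x"
    and bnd: "eventually (\<lambda>t. \<bar>u t\<bar> \<le> B) F"
    and small: "\<And>e. e > 0 \<Longrightarrow> eventually (\<lambda>t. \<phi> (u t) < e) F"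
  shows "(u \<longlongrightarrow> 0) F"
proof (rule tendstoI)
  fix e :: real assume e: "e > 0"
  define C where "C = {- B..B} \<inter> {x. e \<le> \<bar>x\<bar>}"
  have "closed {x::real. e \<le> \<bar>x\<bar>}"
    by (intro closed_Collect_le continuous_intros)
  then have C: "compact C" unfolding C_def by (intro compact_Int_closed compact_Icc)
  have "\<exists>m>0. \<forall>x\<in>C. m \<le> \<phi> x"
  proof (cases "C = {}")
    case False
    obtain x where x: "x \<in> C" "\<And>y. y \<in> C \<Longrightarrow> \<phi> x \<le> \<phi> y"
      using continuous_attains_inf[OF C False continuous_on_subset[OF cont]] by auto
    have "x \<noteq> 0" using x(1) e by (auto simp: C_def)
    then show ?thesis using x(2) pos by blast
  qed (auto intro: exI[of _ 1])
  then obtain m where m: "m > 0" "\<And>x. x \<in> C \<Longrightarrow> m \<le> \<phi> x" by blast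
  show "eventually (\<lambda>t. dist (u t) 0 < e) F"
    using small[OF m(1)] bnd
  proof eventually_elim
    case (elim t)
    then have "u t \<notin> C" using m(2) by fastforce
    then show ?case using elim(2) by (auto simp: C_def abs_le_iff)
  qed
qed

section \<open>Sums over ordered pairs of vehicles\<close>

lemma sum_offdiag_swap:
  fixes a :: "'n::finite \<Rightarrow> 'n \<Rightarrow> real"
  shows "(\<Sum>i\<in>UNIV. \<Sum>j\<in>UNIV - {i}. a j i) = (\<Sum>i\<in>UNIV. \<Sum>j\<in>UNIV - {i}. a i j)"
proof -
  have *: "(\<Sum>j\<in>UNIV - {i}. b j) = (\<Sum>j\<in>UNIV. if j = i then 0 else b j)" for b :: "'n \<Rightarrow> real" and i
    by (rule sum.mono_neutral_cong_left) auto
  show ?thesis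
    unfolding * by (subst sum.swap) (auto intro!: sum.cong)
qed

text \<open>
The action-equals-reaction principle for pair interactions.
\<close>

lemma sum_offdiag_antisym:
  fixes a :: "'n::finite \<Rightarrow> 'n \<Rightarrow> real"
  assumes "\<And>i j. i \<noteq> j \<Longrightarrow> a j i = - a i j"
  shows "(\<Sum>i\<in>UNIV. \<Sum>j\<in>UNIV - {i}. a i j) = 0"
proof -
  have "(\<Sum>i\<in>UNIV. \<Sum>j\<in>UNIV - {i}. a j i) = (\<Sum>i\<in>UNIV. \<Sum>j\<in>UNIV - {i}. - a i j)"
    by (intro sum.cong refl assms) auto
  then show ?thesis using sum_offdiag_swap[of a] by (simp add: sum_negf)
qed

text \<open>
Adding the sum to itself with the indices exchanged leaves the terms
\<open>- k\<^sub>i\<^sub>j (x\<^sub>i - x\<^sub>j) (h\<^sub>i - h\<^sub>j)\<close>, and \<open>h\<close> is ordered like \<open>x\<close>.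
\<close>

lemma consensus_sum_nonpos:
  fixes k :: "'n::finite \<Rightarrow> 'n \<Rightarrow> real" and x h :: "'n \<Rightarrow> real"
  assumes k: "\<And>i j. i \<noteq> j \<Longrightarrow> 0 \<le> k i j" "\<And>i j. i \<noteq> j \<Longrightarrow> k i j = k j i"
    and mono: "\<And>i j. x i \<le> x j \<Longrightarrow> h i \<le> h j"
  shows "(\<Sum>i\<in>UNIV. x i * (\<Sum>j\<in>UNIV - {i}. k i j * (h j - h i))) \<le> 0"
proof -
  define S where "S = (\<Sum>i\<in>UNIV. \<Sum>j\<in>UNIV - {i}. x i * (k i j * (h j - h i)))"
  have "S = (\<Sum>i\<in>UNIV. \<Sum>j\<in>UNIV - {i}. x j * (k j i * (h i - h j)))"
    unfolding S_def by (rule sum_offdiag_swap[symmetric])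
  then have "S + S = (\<Sum>i\<in>UNIV. \<Sum>j\<in>UNIV - {i}. x i * (k i j * (h j - h i)) + x j * (k j i * (h i - h j)))"
    unfolding sum.distrib by (simp add: S_def)
  also have "\<dots> \<le> (\<Sum>i\<in>(UNIV::'n set). \<Sum>j\<in>UNIV - {i}. 0)"
  proof (intro sum_mono)
    fix i j :: 'n assume "j \<in> UNIV - {i}"
    then have ij: "i \<noteq> j" by auto
    have "(x i - x j) * (h i - h j) \<ge> 0"
      using mono[of i j] mono[of j i] by (cases "x i \<le> x j") (auto simp: zero_le_mult_iff)
    then have "k i j * ((x i - x j) * (h i - h j)) \<ge> 0" using k(1)[OF ij] by simp
    then show "x i * (k i j * (h j - h i)) + x j * (k j i * (h i - h j)) \<le> 0"
      using k(2)[OF ij] by (simp add: algebra_simps)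
  qed
  finally have "S \<le> 0" by simp
  then show ?thesis by (simp add: S_def sum_distrib_left)
qed

section \<open>The closed loop and its rotational symmetry\<close>

definition cruise_field :: "'n::finite params \<Rightarrow> 'n state \<Rightarrow> 'n state" where
  "cruise_field P w = vehicle_field P (F_law P w) (delta_law P w) w"

text \<open>
The rate of change of the heading that the steering law enforces.
\<close>

definition steer_rate :: "'n::finite params \<Rightarrow> 'n state \<Rightarrow> 'n \<Rightarrow> real" where
  "steer_rate P w i = - (f2 P (sin (st_s w i))
      + (zeta_fun P (st_s w i) (st_v w i) * F_law P w i + Z_fun P w i) * st_v w i - M_fun P w i)
    / gamma_fun P (st_r w i) (st_s w i) (st_v w i)"

text \<open>
Adding \<open>k i\<close> full turns to the polar angle of each vehicle \<open>i\<close>.  The laws see the polar angles only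
through the sines and cosines of their differences, so these translations are symmetries; they make up
for the unboundedness of the angles.
\<close>

definition turn :: "('n::finite \<Rightarrow> int) \<Rightarrow> 'n state" where
  "turn k = (0, \<chi> i. 2 * pi * of_int (k i), 0, 0)"

lemma turn_simps [simp]:
  "st_r (w + turn k) i = st_r w i" "st_s (w + turn k) i = st_s w i" "st_v (w + turn k) i = st_v w i"
  "st_phi (w + turn k) i = st_phi w i + 2 * pi * of_int (k i)"
  by (auto simp: st_r_def st_s_def st_v_def st_phi_def turn_def)

lemma turn_diff:
  "sin (st_phi (w + turn k) i - st_phi (w + turn k) j) = sin (st_phi w i - st_phi w j)"
  "cos (st_phi (w + turn k) i - st_phi (w + turn k) j) = cos (st_phi w i - st_phi w j)"
proof -
  have eq: "st_phi (w + turn k) i - st_phi (w + turn k) j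
      = (st_phi w i - st_phi w j) + 2 * pi * of_int (k i - k j)"
    by (simp add: algebra_simps)
  have s: "sin (2 * pi * real_of_int (k i - k j)) = 0"
    by (rule sin_int_2pin)
  have c: "cos (2 * pi * real_of_int (k i - k j)) = 1"
    by (rule cos_int_2pin)
  show "sin (st_phi (w + turn k) i - st_phi (w + turn k) j) = sin (st_phi w i - st_phi w j)"
    "cos (st_phi (w + turn k) i - st_phi (w + turn k) j) = cos (st_phi w i - st_phi w j)"
    unfolding eq sin_add cos_add s c by auto
qed

lemma turn_invariant:
  "vdist P (w + turn k) i j = vdist P w i j"
  "ang_speed (w + turn k) i = ang_speed w i"
  "Phi_fun P (w + turn k) i = Phi_fun P w i"
  "G_fun P (w + turn k) i = G_fun P w i"
  "M_fun P (w + turn k) i = M_fun P w i"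
  "Z_fun P (w + turn k) i = Z_fun P w i"
proof -
  show v: "vdist P (w + turn k) i j = vdist P w i j" for i j
    unfolding vdist_def turn_diff by simp
  show a: "ang_speed (w + turn k) i = ang_speed w i" for i
    by (simp add: ang_speed_def)
  show "Phi_fun P (w + turn k) i = Phi_fun P w i"
    "G_fun P (w + turn k) i = G_fun P w i"
    "M_fun P (w + turn k) i = M_fun P w i"
    "Z_fun P (w + turn k) i = Z_fun P w i"
    unfolding Phi_fun_def G_fun_def M_fun_def Z_fun_def v a turn_diff by simp_all
qed

lemma turn_invariant_closed_loop:
  "F_law P (w + turn k) i = F_law P w i"
  "delta_law P (w + turn k) i = delta_law P w i"
  "steer_rate P (w + turn k) i = steer_rate P w i"
  "H_R P (w + turn k) = H_R P w"
  "w + turn k \<in> Omega P \<longleftrightarrow> w \<in> Omega P"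
  by (simp_all add: F_law_def delta_law_def steer_rate_def H_R_def Omega_def turn_invariant del: turn_simps(4))

lemma cruise_field_turn: "cruise_field P (w + turn k) = cruise_field P w"
proof -
  have "F_law P (w + turn k) = F_law P w" "delta_law P (w + turn k) = delta_law P w"
    by (auto simp: turn_invariant_closed_loop)
  then show ?thesis unfolding cruise_field_def vehicle_field_def by simp
qed

lemma turn_into_period: "\<exists>k. \<forall>i. st_phi (w + turn k) i \<in> {0..2*pi}"
proof (intro exI allI)
  fix i
  define x where "x = st_phi w i / (2*pi)"
  have "st_phi w i = 2 * pi * x" by (simp add: x_def)
  then have eq: "st_phi (w + turn (\<lambda>i. - \<lfloor>st_phi w i / (2*pi)\<rfloor>)) i = 2 * pi * (x - of_int \<lfloor>x\<rfloor>)"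
    by (simp add: x_def[symmetric] algebra_simps)
  have "0 \<le> x - of_int \<lfloor>x\<rfloor>" "x - of_int \<lfloor>x\<rfloor> \<le> 1" by linarith+
  then have "2 * pi * (x - of_int \<lfloor>x\<rfloor>) \<le> 2 * pi * 1" "0 \<le> 2 * pi * (x - of_int \<lfloor>x\<rfloor>)"
    by (auto intro: mult_left_mono)
  then show "st_phi (w + turn (\<lambda>i. - \<lfloor>st_phi w i / (2*pi)\<rfloor>)) i \<in> {0..2*pi}"
    unfolding eq by simp
qed

lemma component_bounded_linear:
  "bounded_linear (\<lambda>w. st_r w i)" "bounded_linear (\<lambda>w. st_phi w i)"
  "bounded_linear (\<lambda>w. st_s w i)" "bounded_linear (\<lambda>w. st_v w i)"
  unfolding st_r_def st_phi_def st_s_def st_v_def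
  by (intro bounded_linear_compose[OF bounded_linear_vec_nth] bounded_linear_compose[OF bounded_linear_fst]
      bounded_linear_compose[OF bounded_linear_snd] bounded_linear_fst bounded_linear_snd bounded_linear_ident)+

lemma component_has_derivative:
  assumes "(w has_vector_derivative D) (at t within S)"
  shows "((\<lambda>t. st_r (w t) i) has_real_derivative st_r D i) (at t within S)"
    "((\<lambda>t. st_phi (w t) i) has_real_derivative st_phi D i) (at t within S)"
    "((\<lambda>t. st_s (w t) i) has_real_derivative st_s D i) (at t within S)"
    "((\<lambda>t. st_v (w t) i) has_real_derivative st_v D i) (at t within S)"
  unfolding has_real_derivative_iff_has_vector_derivative
  using component_bounded_linear[THEN bounded_linear.has_vector_derivative, OF assms] by auto

lemmas component_lipschitz_near [lipschitz_near_intros] =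
  component_bounded_linear[THEN lipschitz_near_bounded_linear]

section \<open>Consequences of the standing assumptions\<close>

locale admissible_params =
  fixes P :: "'n::finite params"
  assumes adm: "admissible P"
begin

lemma parameter_bounds:
  "0 < Rin P" "Rin P < Rout P" "0 < vmax P" "0 < omega P" "omega P < vmax P / Rout P"
  "0 < Theta P" "Theta P < pi / 2" "Rout P * omega P / vmax P < cos (Theta P)" "0 < sigma P i"
  "0 < Acoef P" "1 / (Rin P)\<^sup>2 < bcoef P"
  using adm unfolding admissible_def by auto

lemma couplings:
  assumes "i \<noteq> j"
  shows "pcoef P i j = pcoef P j i" "0 < pcoef P i j" "Lmin P i j = Lmin P j i" "0 < Lmin P i j"
    "d > Lmin P i j \<Longrightarrow> 0 \<le> Vpot P i j d" "d > Lmin P i j \<Longrightarrow> Vpot P i j d = Vpot P j i d"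
    "Vpot P i j C1_differentiable_on {Lmin P i j <..}"
    "deriv (Vpot P i j) C1_differentiable_on {Lmin P i j <..}"
    "filterlim (Vpot P i j) at_top (at_right (Lmin P i j))"
    "d > Lmin P i j \<Longrightarrow> 0 \<le> kappa P i j d" "d > Lmin P i j \<Longrightarrow> kappa P i j d = kappa P j i d"
    "kappa P i j C1_differentiable_on {Lmin P i j <..}"
  using adm assms unfolding admissible_def C2_differentiable_on_def by auto

lemma road_potential:
  "r \<in> {Rin P <..< Rout P} \<Longrightarrow> 0 \<le> Upot P i r"
  "Upot P i C1_differentiable_on {Rin P <..< Rout P}"
  "deriv (Upot P i) C1_differentiable_on {Rin P <..< Rout P}"
  "filterlim (Upot P i) at_top (at_right (Rin P))"
  "filterlim (Upot P i) at_top (at_left (Rout P))"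
  using adm unfolding admissible_def C2_differentiable_on_def by auto

lemma feedback_functions:
  "g1 P C1_differentiable_on UNIV" "mono (g1 P)" "g2 P C1_differentiable_on UNIV" "mono (g2 P)"
  "f1 P C1_differentiable_on UNIV" "f1 P 0 = 0" "x \<noteq> 0 \<Longrightarrow> 0 < x * f1 P x"
  "f2 P C1_differentiable_on UNIV" "f2 P 0 = 0" "x \<noteq> 0 \<Longrightarrow> 0 < x * f2 P x"
  using adm unfolding admissible_def by auto

lemma damping_nonneg: "0 \<le> x * f1 P x" "0 \<le> x * f2 P x"
  using feedback_functions(6,9) feedback_functions(7,10)[of x] by (cases "x = 0"; simp)+

lemma damping_continuous: "continuous_on UNIV (f1 P)" "continuous_on UNIV (f2 P)"
  using feedback_functions(5,8) by (auto simp: C1_differentiable_imp_continuous_on)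

lemma cos_Theta: "0 < cos (Theta P)"
  using parameter_bounds by (intro cos_gt_zero_pi) auto

lemma cos_gt_cos_Theta:
  assumes "s \<in> {- Theta P<..<Theta P}"
  shows "cos (Theta P) < cos s"
proof -
  have "cos (Theta P) < cos \<bar>s\<bar>"
    by (rule cos_monotone_0_pi) (use assms parameter_bounds pi_gt_zero in auto)
  then show ?thesis by simp
qed

lemma OmegaD:
  assumes "w \<in> Omega P"
  shows "Rin P < st_r w i" "st_r w i < Rout P" "0 < st_r w i"
    "- Theta P < st_s w i" "st_s w i < Theta P"
    "0 < st_v w i" "st_v w i < vmax P"
    "cos (Theta P) < cos (st_s w i)" "0 < cos (st_s w i)"
    "i \<noteq> j \<Longrightarrow> Lmin P i j < vdist P w i j" "i \<noteq> j \<Longrightarrow> 0 < vdist P w i j"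
proof -
  have 1: "st_r w i \<in> {Rin P <..< Rout P}" "st_s w i \<in> {- Theta P <..< Theta P}"
    "st_v w i \<in> {0 <..< vmax P}" "i \<noteq> j \<Longrightarrow> Lmin P i j < vdist P w i j"
    using assms unfolding Omega_def by auto
  show "Rin P < st_r w i" "st_r w i < Rout P" "0 < st_r w i"
    "- Theta P < st_s w i" "st_s w i < Theta P"
    "0 < st_v w i" "st_v w i < vmax P"
    using 1 parameter_bounds by auto
  show c: "cos (Theta P) < cos (st_s w i)" by (rule cos_gt_cos_Theta) (use 1 in auto)
  then show "0 < cos (st_s w i)" using cos_Theta by linarith
  show "i \<noteq> j \<Longrightarrow> Lmin P i j < vdist P w i j" by (rule 1)
  then show "i \<noteq> j \<Longrightarrow> 0 < vdist P w i j" using couplings(4)[of i j] by fastforce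
qed

lemma vdist_radicand_pos:
  assumes "w \<in> Omega P" "i \<noteq> j"
  shows "0 < pcoef P i j * (st_r w i - st_r w j)\<^sup>2
           + 2 * st_r w i * st_r w j * (1 - cos (st_phi w i - st_phi w j))"
  using OmegaD(11)[OF assms] unfolding vdist_def by simp

lemma vdist_commute: "i \<noteq> j \<Longrightarrow> vdist P w i j = vdist P w j i"
  unfolding vdist_def using couplings(1)[of i j]
  by (simp add: cos_diff power2_commute mult_ac)

lemma bcoef_gt: "w \<in> Omega P \<Longrightarrow> 1 / (st_r w i)\<^sup>2 < bcoef P"
proof -
  assume w: "w \<in> Omega P"
  have "(Rin P)\<^sup>2 \<le> (st_r w i)\<^sup>2" using OmegaD(1)[OF w] parameter_bounds by (intro power_mono) (auto intro: less_imp_le)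
  then have "1 / (st_r w i)\<^sup>2 \<le> 1 / (Rin P)\<^sup>2" using parameter_bounds OmegaD(3)[OF w, of i] by (intro divide_left_mono) auto
  then show ?thesis using parameter_bounds(11) by linarith
qed

text \<open>
By the condition on \<open>\<Theta>\<close>, \<open>v\<^sub>m\<^sub>a\<^sub>x cos s\<close> exceeds \<open>R\<^sub>o\<^sub>u\<^sub>t \<omega>\<close> and hence \<open>r \<omega>\<close>, so the
numerator is greater than \<open>r \<omega> (v\<^sub>m\<^sub>a\<^sub>x - v)\<close>.
\<close>

lemma q_pos:
  assumes w: "w \<in> Omega P"
  shows "0 < q_fun P (st_r w i) (st_s w i) (st_v w i)"
proof -
  define r s v where "r = st_r w i" "s = st_s w i" "v = st_v w i"
  have h: "0 < r" "r < Rout P" "0 < v" "v < vmax P" "cos (Theta P) < cos s" "0 < cos s"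
    using OmegaD[OF w] by (auto simp: r_s_v_def)
  have "Rout P * omega P < cos (Theta P) * vmax P"
    using parameter_bounds by (simp add: field_simps)
  also have "\<dots> < cos s * vmax P" using h parameter_bounds by simp
  finally have 1: "Rout P * omega P < vmax P * cos s" by (simp add: mult.commute)
  have "r * omega P < Rout P * omega P" using h parameter_bounds by simp
  then have "v * (r * omega P) < v * (vmax P * cos s)" using 1 h by simp
  moreover have "0 < r * omega P * (vmax P - v)" using h parameter_bounds by simp
  ultimately have "0 < vmax P * v * cos s - 2 * r * v * omega P + r * omega P * vmax P"
    by (simp add: algebra_simps)
  then show ?thesis unfolding q_fun_def r_s_v_def[symmetric] using h by simp
qed

lemma gamma_pos:
  assumes w: "w \<in> Omega P"
  shows "0 < gamma_fun P (st_r w i) (st_s w i) (st_v w i)"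
  unfolding gamma_fun_def using OmegaD[OF w, of i] parameter_bounds bcoef_gt[OF w, of i]
  by (intro add_pos_pos mult_pos_pos divide_pos_pos) auto

text \<open>
The tangent in the model undoes the arctangent in the steering law, whose first summand
cancels the rotation of the polar frame.
\<close>

lemma cruise_field_components:
  assumes w: "w \<in> Omega P"
  shows "st_r (cruise_field P w) i = - st_v w i * sin (st_s w i)"
    "st_phi (cruise_field P w) i = ang_speed w i"
    "st_s (cruise_field P w) i = steer_rate P w i"
    "st_v (cruise_field P w) i = F_law P w i"
proof -
  show "st_r (cruise_field P w) i = - st_v w i * sin (st_s w i)"
    "st_phi (cruise_field P w) i = ang_speed w i"
    "st_v (cruise_field P w) i = F_law P w i"
    by (auto simp: cruise_field_def vehicle_field_def st_r_def st_phi_def st_v_def st_s_def ang_speed_def)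
  have "st_s (cruise_field P w) i
      = st_v w i / sigma P i * tan (delta_law P w i) - st_v w i / st_r w i * cos (st_s w i)"
    by (simp add: cruise_field_def vehicle_field_def st_r_def st_phi_def st_v_def st_s_def)
  also have "\<dots> = steer_rate P w i"
    unfolding delta_law_def steer_rate_def tan_arctan
    using OmegaD[OF w, of i] gamma_pos[OF w, of i] parameter_bounds(9)[of i]
    by (simp add: right_diff_distrib add_divide_distrib diff_divide_distrib)
  finally show "st_s (cruise_field P w) i = steer_rate P w i" .
qed

lemma open_Omega: "open (Omega P)"
proof -
  have c: "continuous_on UNIV (\<lambda>w::'n state. st_r w i)" "continuous_on UNIV (\<lambda>w::'n state. st_s w i)"
    "continuous_on UNIV (\<lambda>w::'n state. st_v w i)" "continuous_on UNIV (\<lambda>w::'n state. st_phi w i)" for i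
    by (auto intro!: linear_continuous_on component_bounded_linear)
  have d: "continuous_on UNIV (\<lambda>w. vdist P w i j)" for i j
    unfolding vdist_def by (intro continuous_intros c)
  have "Omega P = (\<Inter>i. ({w. Rin P < st_r w i} \<inter> {w. st_r w i < Rout P})
      \<inter> ({w. - Theta P < st_s w i} \<inter> {w. st_s w i < Theta P})
      \<inter> ({w. 0 < st_v w i} \<inter> {w. st_v w i < vmax P})
      \<inter> (\<Inter>j\<in>UNIV - {i}. {w. Lmin P i j < vdist P w i j}))"
    unfolding Omega_def by auto
  also have "open \<dots>"
    by (intro open_INT open_Int finite ballI open_Collect_less c d continuous_intros)
  finally show ?thesis .
qed

section \<open>Regularity of the closed loop\<close>

lemma lipschitz_near_feedback [lipschitz_near_intros]:
  fixes f :: "'a::metric_space \<Rightarrow> real"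
  assumes "lipschitz_near f x"
  shows "lipschitz_near (\<lambda>x. g1 P (f x)) x" "lipschitz_near (\<lambda>x. g2 P (f x)) x"
    "lipschitz_near (\<lambda>x. f1 P (f x)) x" "lipschitz_near (\<lambda>x. f2 P (f x)) x"
  by (rule lipschitz_near_compose[OF assms], rule lipschitz_near_C1[OF _ open_UNIV UNIV_I],
      rule feedback_functions)+

lemma lipschitz_near_vdist [lipschitz_near_intros]:
  assumes "w \<in> Omega P" "i \<noteq> j"
  shows "lipschitz_near (\<lambda>w. vdist P w i j) w"
  unfolding vdist_def by (intro lipschitz_near_intros vdist_radicand_pos assms)

lemma lipschitz_near_ang_speed [lipschitz_near_intros]:
  assumes "w \<in> Omega P"
  shows "lipschitz_near (\<lambda>w. ang_speed w i) w"
  unfolding ang_speed_def using OmegaD[OF assms, of i] by (intro lipschitz_near_intros) auto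

lemma lipschitz_near_coupling [lipschitz_near_intros]:
  assumes "w \<in> Omega P" "i \<noteq> j"
  shows "lipschitz_near (\<lambda>w. Vpot P i j (vdist P w i j)) w"
    "lipschitz_near (\<lambda>w. deriv (Vpot P i j) (vdist P w i j)) w"
    "lipschitz_near (\<lambda>w. kappa P i j (vdist P w i j)) w"
  using OmegaD(10)[OF assms]
  by (auto intro!: lipschitz_near_compose[OF lipschitz_near_vdist[OF assms]]
      intro: lipschitz_near_C1[OF couplings(7)] lipschitz_near_C1[OF couplings(8)]
        lipschitz_near_C1[OF couplings(12)] simp: assms)

lemma lipschitz_near_road [lipschitz_near_intros]:
  assumes "w \<in> Omega P"
  shows "lipschitz_near (\<lambda>w. Upot P i (st_r w i)) w"
    "lipschitz_near (\<lambda>w. deriv (Upot P i) (st_r w i)) w"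
  using OmegaD[OF assms, of i]
  by (auto intro!: lipschitz_near_compose[OF component_lipschitz_near(1)]
      intro: lipschitz_near_C1[OF road_potential(2)] lipschitz_near_C1[OF road_potential(3)])

lemma lipschitz_near_coefficients [lipschitz_near_intros]:
  assumes "w \<in> Omega P"
  shows "lipschitz_near (\<lambda>w. q_fun P (st_r w i) (st_s w i) (st_v w i)) w"
    "lipschitz_near (\<lambda>w. gamma_fun P (st_r w i) (st_s w i) (st_v w i)) w"
    "lipschitz_near (\<lambda>w. zeta_fun P (st_s w i) (st_v w i)) w"
  using OmegaD[OF assms, of i] unfolding q_fun_def gamma_fun_def zeta_fun_def
  by (auto intro!: lipschitz_near_intros)

lemma lipschitz_near_interactions [lipschitz_near_intros]:
  assumes "w \<in> Omega P"
  shows "lipschitz_near (\<lambda>w. Z_fun P w i) w" "lipschitz_near (\<lambda>w. Phi_fun P w i) w"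
    "lipschitz_near (\<lambda>w. G_fun P w i) w" "lipschitz_near (\<lambda>w. M_fun P w i) w"
proof -
  have j: "i \<noteq> j" "vdist P w i j \<noteq> 0" if "j \<in> UNIV - {i}" for j
    using that OmegaD(11)[OF assms, of i j] by auto
  have o: "omega P \<noteq> 0" "(vmax P - st_v w i) * (st_r w i)\<^sup>2 \<noteq> 0"
    using parameter_bounds OmegaD[OF assms, of i] by auto
  show "lipschitz_near (\<lambda>w. Z_fun P w i) w" "lipschitz_near (\<lambda>w. Phi_fun P w i) w"
    "lipschitz_near (\<lambda>w. G_fun P w i) w" "lipschitz_near (\<lambda>w. M_fun P w i) w"
    unfolding Z_fun_def Phi_fun_def G_fun_def M_fun_def
    by (intro lipschitz_near_intros assms j o; assumption)+
qed

lemma lipschitz_near_closed_loop [lipschitz_near_intros]: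
  assumes "w \<in> Omega P"
  shows "lipschitz_near (\<lambda>w. F_law P w i) w" "lipschitz_near (\<lambda>w. steer_rate P w i) w"
proof -
  have nz: "q_fun P (st_r w i) (st_s w i) (st_v w i) \<noteq> 0"
    "gamma_fun P (st_r w i) (st_s w i) (st_v w i) \<noteq> 0"
    using q_pos[OF assms, of i] gamma_pos[OF assms, of i] by auto
  show F: "lipschitz_near (\<lambda>w. F_law P w i) w"
    unfolding F_law_def by (intro lipschitz_near_intros assms nz)
  show "lipschitz_near (\<lambda>w. steer_rate P w i) w"
    unfolding steer_rate_def by (intro lipschitz_near_intros assms nz F)
qed

lemma lipschitz_near_cruise_field [lipschitz_near_intros]:
  assumes w: "w \<in> Omega P"
  shows "lipschitz_near (cruise_field P) w"
proof (rule lipschitz_near_cong[OF _ open_Omega w])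
  show "lipschitz_near (\<lambda>w. (\<chi> i. - st_v w i * sin (st_s w i), \<chi> i. ang_speed w i,
      \<chi> i. steer_rate P w i, \<chi> i. F_law P w i)) w"
    by (intro lipschitz_near_intros w)
  show "cruise_field P y = (\<chi> i. - st_v y i * sin (st_s y i), \<chi> i. ang_speed y i,
      \<chi> i. steer_rate P y i, \<chi> i. F_law P y i)" if "y \<in> Omega P" for y
    using cruise_field_components[OF that] unfolding st_r_def st_phi_def st_v_def st_s_def
    by (simp add: prod_eq_iff vec_eq_iff)
qed

lemma lipschitz_near_H_R [lipschitz_near_intros]:
  assumes "w \<in> Omega P"
  shows "lipschitz_near (H_R P) w"
proof -
  have nz: "(vmax P - st_v w i) * st_v w i \<noteq> 0" "cos (st_s w i) - cos (Theta P) \<noteq> 0"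
    "1 - cos (Theta P) \<noteq> 0" for i
    using OmegaD[OF assms, of i] less_le_trans[OF OmegaD(8)[OF assms, of i] cos_le_one] by auto
  show ?thesis
    unfolding H_R_def[abs_def]
    by (intro lipschitz_near_intros assms nz) auto
qed

end

section \<open>The Lyapunov function decreases\<close>

text \<open>
The derivative of \<^const>\<open>H_R\<close> at \<open>w\<close> in the direction \<open>D\<close>, collected so that the coefficients are
exactly the quantities that occur in the feedback laws.
\<close>

definition lyap_slope :: "'n::finite params \<Rightarrow> 'n state \<Rightarrow> 'n state \<Rightarrow> real" where
  "lyap_slope P w D = (\<Sum>i\<in>UNIV.
      ((ang_speed w i - omega P) * q_fun P (st_r w i) (st_s w i) (st_v w i)
        + zeta_fun P (st_s w i) (st_v w i) * st_v w i * sin (st_s w i)) * st_v D i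
      + gamma_fun P (st_r w i) (st_s w i) (st_v w i) * sin (st_s w i) * st_s D i
      - Z_fun P w i * st_r D i
      + omega P * Phi_fun P w i * st_phi D i)"

text \<open>
The coefficients of \<open>v'\<close>, \<open>s'\<close> and \<open>r'\<close> are compared one at a time, which keeps the rational
identities small; the one of \<open>v'\<close> explains where \<open>q\<close> and \<open>\<zeta>\<close> come from.
\<close>

lemma kinetic_has_derivative:
  fixes r s v :: "real \<Rightarrow> real"
  assumes d [derivative_intros]: "(r has_real_derivative r') (at t within S)" "(s has_real_derivative s') (at t within S)"
      "(v has_real_derivative v') (at t within S)"
    and nz: "r t > 0" "v t > 0" "v t < vmax P"
  shows "((\<lambda>t. ((v t / r t * cos (s t) - omega P)\<^sup>2 + bcoef P * (v t)\<^sup>2 * (sin (s t))\<^sup>2)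
        / ((vmax P - v t) * v t)) has_real_derivative
     2 * (((v t / r t * cos (s t) - omega P) * q_fun P (r t) (s t) (v t)
            + zeta_fun P (s t) (v t) * v t * sin (s t)) * v'
         + (v t * cos (s t) / (vmax P - v t) * (bcoef P - 1 / (r t)\<^sup>2)
            + omega P / (r t * (vmax P - v t))) * sin (s t) * s'
         - (v t / r t * cos (s t) - omega P) * (cos (s t) / ((vmax P - v t) * (r t)\<^sup>2)) * r'))
     (at t within S)"
proof -
  define m where "m = vmax P - v t"
  define R V c n y where defs: "R = r t" "V = v t" "c = cos (s t)" "n = sin (s t)" "y = V / R * c - omega P"
  have pos: "m \<noteq> 0" "R \<noteq> 0" "V \<noteq> 0" using nz by (auto simp: m_def defs)
  have vm: "vmax P = m + V" by (simp add: m_def defs)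
  have r': "2 * y * (- (V * c) / R\<^sup>2) / (m * V) = - (2 * y * (c / (m * R\<^sup>2)))"
    using pos by (simp add: field_simps)
  have s': "(2 * y * (- V * n / R) + bcoef P * (2 * V\<^sup>2 * n * c)) / (m * V)
      = 2 * ((V * c / m * (bcoef P - 1 / R\<^sup>2) + omega P / (R * m)) * n)"
    unfolding defs(5) using pos by (simp add: field_simps) (simp add: algebra_simps power2_eq_square power4_eq_xxxx)
  have yv: "2 * y * (c / R) / (m * V) - y\<^sup>2 * (m - V) / (m * V)\<^sup>2
      = 2 * (y * ((vmax P * V * c - 2 * R * V * omega P + R * omega P * vmax P) / (2 * R * m\<^sup>2 * V\<^sup>2)))"
  proof -
    have "2 * (c / R) / (m * V) - y * (m - V) / (m * V)\<^sup>2
      = 2 * ((vmax P * V * c - 2 * R * V * omega P + R * omega P * vmax P) / (2 * R * m\<^sup>2 * V\<^sup>2))"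
      unfolding defs(5) vm using pos by (simp add: field_simps) (simp add: algebra_simps power2_eq_square power4_eq_xxxx)
    then have "y * (2 * (c / R) / (m * V) - y * (m - V) / (m * V)\<^sup>2)
      = y * (2 * ((vmax P * V * c - 2 * R * V * omega P + R * omega P * vmax P) / (2 * R * m\<^sup>2 * V\<^sup>2)))"
      by simp
    then show ?thesis by (simp add: algebra_simps power2_eq_square power4_eq_xxxx)
  qed
  have bv: "bcoef P * (2 * V * n\<^sup>2) / (m * V) - bcoef P * V\<^sup>2 * n\<^sup>2 * (m - V) / (m * V)\<^sup>2
      = 2 * (bcoef P * vmax P * n / (2 * m\<^sup>2 * V) * V * n)"
    unfolding vm using pos by (simp add: field_simps) (simp add: algebra_simps power2_eq_square power4_eq_xxxx)
  define y' where "y' = v' * (c / R) + s' * (- V * n / R) + r' * (- (V * c) / R\<^sup>2)"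
  have dy: "((\<lambda>t. v t / r t * cos (s t) - omega P) has_real_derivative y') (at t within S)"
    unfolding y'_def using pos
    by (auto intro!: derivative_eq_intros simp: defs field_simps power2_eq_square)
  have dn: "((\<lambda>t. bcoef P * (v t)\<^sup>2 * (sin (s t))\<^sup>2) has_real_derivative
      bcoef P * (2 * V * n\<^sup>2) * v' + bcoef P * (2 * V\<^sup>2 * n * c) * s') (at t within S)"
    by (auto intro!: derivative_eq_intros simp: defs algebra_simps power2_eq_square power4_eq_xxxx)
  have dd: "((\<lambda>t. (vmax P - v t) * v t) has_real_derivative (m - V) * v') (at t within S)"
    by (auto intro!: derivative_eq_intros simp: defs m_def algebra_simps)
  define N' where "N' = 2 * y * y' + (bcoef P * (2 * V * n\<^sup>2) * v' + bcoef P * (2 * V\<^sup>2 * n * c) * s')"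
  have dN: "((\<lambda>t. (v t / r t * cos (s t) - omega P)\<^sup>2 + bcoef P * (v t)\<^sup>2 * (sin (s t))\<^sup>2)
      has_real_derivative N') (at t within S)"
    unfolding N'_def
    by (rule derivative_eq_intros dy dn refl)+ (simp add: defs)
  define E where "E = y\<^sup>2 + bcoef P * V\<^sup>2 * n\<^sup>2"
  have "((\<lambda>t. ((v t / r t * cos (s t) - omega P)\<^sup>2 + bcoef P * (v t)\<^sup>2 * (sin (s t))\<^sup>2)
        / ((vmax P - v t) * v t)) has_real_derivative
      (N' * (m * V) - E * ((m - V) * v')) / (m * V * (m * V))) (at t within S)"
    using DERIV_divide[OF dN dd] pos by (simp add: defs m_def E_def)
  moreover have "(N' * (m * V) - E * ((m - V) * v')) / (m * V * (m * V))
      = N' / (m * V) - E * (m - V) / (m * V)\<^sup>2 * v'"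
    using pos by (simp add: diff_divide_distrib power2_eq_square)
  moreover have "\<dots> = ((2 * y * (c / R) / (m * V) - y\<^sup>2 * (m - V) / (m * V)\<^sup>2)
        + (bcoef P * (2 * V * n\<^sup>2) / (m * V) - bcoef P * V\<^sup>2 * n\<^sup>2 * (m - V) / (m * V)\<^sup>2)) * v'
      + (2 * y * (- V * n / R) + bcoef P * (2 * V\<^sup>2 * n * c)) / (m * V) * s'
      + 2 * y * (- (V * c) / R\<^sup>2) / (m * V) * r'"
    unfolding N'_def E_def y'_def
    by (simp add: add_divide_distrib diff_divide_distrib ring_distribs mult_ac)
  ultimately show ?thesis
    unfolding yv bv s' r' q_fun_def zeta_fun_def defs(1-4)[symmetric] m_def[unfolded defs(2)[symmetric], symmetric]
      defs(5)[symmetric]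
    by (simp only: ring_distribs mult_ac minus_mult_left[symmetric] minus_mult_right[symmetric] mult_minus_left mult_minus_right diff_conv_add_uminus)
qed

context admissible_params
begin

text \<open>
The symmetry of the potentials holds beyond the minimal distance only, which suffices because a
derivative depends only on the values near the point.
\<close>

lemma deriv_Vpot_commute:
  assumes "w \<in> Omega P" "i \<noteq> j"
  shows "deriv (Vpot P j i) (vdist P w j i) = deriv (Vpot P i j) (vdist P w i j)"
proof -
  have "\<forall>\<^sub>F d in nhds (vdist P w i j). Vpot P j i d = Vpot P i j d"
    using eventually_nhds_in_open[of "{Lmin P i j<..}" "vdist P w i j"] OmegaD(10)[OF assms]
      couplings(6)[OF assms(2)] by (auto elim: eventually_mono)
  then have "deriv (Vpot P j i) (vdist P w i j) = deriv (Vpot P i j) (vdist P w i j)"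
    by (intro deriv_cong_ev) auto
  then show ?thesis using vdist_commute[OF assms(2)] by simp
qed

text \<open>
The power that vehicle \<open>i\<close>, moving with velocity \<open>D\<close>, contributes to the potential of the pair
\<open>i\<close>, \<open>j\<close>.
\<close>

definition pair_slope :: "'n state \<Rightarrow> 'n state \<Rightarrow> 'n \<Rightarrow> 'n \<Rightarrow> real" where
  "pair_slope w D i j = deriv (Vpot P i j) (vdist P w i j) / vdist P w i j *
     ((pcoef P i j * (st_r w i - st_r w j) + st_r w j * (1 - cos (st_phi w i - st_phi w j))) * st_r D i
      + st_r w i * st_r w j * sin (st_phi w i - st_phi w j) * st_phi D i)"

lemma Vpot_has_derivative:
  assumes w: "(w has_vector_derivative D) (at t within S)" "w t \<in> Omega P" and ij: "i \<noteq> j"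
  shows "((\<lambda>t. Vpot P i j (vdist P (w t) i j)) has_real_derivative
     pair_slope (w t) D i j + pair_slope (w t) D j i) (at t within S)"
proof -
  note st = component_has_derivative[OF w(1)]
  define d where "d = vdist P (w t) i j"
  have d: "0 < d" using OmegaD(11)[OF w(2) ij] by (simp add: d_def)
  define a where "a = (pcoef P i j * (st_r (w t) i - st_r (w t) j)
      + st_r (w t) j * (1 - cos (st_phi (w t) i - st_phi (w t) j))) * st_r D i
      + st_r (w t) i * st_r (w t) j * sin (st_phi (w t) i - st_phi (w t) j) * st_phi D i"
  define b where "b = (pcoef P i j * (st_r (w t) j - st_r (w t) i)
      + st_r (w t) i * (1 - cos (st_phi (w t) j - st_phi (w t) i))) * st_r D j
      + st_r (w t) j * st_r (w t) i * sin (st_phi (w t) j - st_phi (w t) i) * st_phi D j"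
  have c: "cos (st_phi (w t) j - st_phi (w t) i) = cos (st_phi (w t) i - st_phi (w t) j)"
    "sin (st_phi (w t) j - st_phi (w t) i) = - sin (st_phi (w t) i - st_phi (w t) j)"
    by (simp_all add: cos_diff sin_diff)
  have rad: "((\<lambda>t. pcoef P i j * (st_r (w t) i - st_r (w t) j)\<^sup>2
        + 2 * st_r (w t) i * st_r (w t) j * (1 - cos (st_phi (w t) i - st_phi (w t) j)))
      has_real_derivative 2 * (a + b)) (at t within S)"
    unfolding a_def b_def c
    by (rule derivative_eq_intros st refl)+ (simp add: algebra_simps)
  have "((\<lambda>t. vdist P (w t) i j) has_real_derivative (2 * (a + b)) * (inverse d / 2)) (at t within S)"
    using DERIV_chain2[OF DERIV_real_sqrt[OF vdist_radicand_pos[OF w(2) ij]] rad]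
    unfolding d_def vdist_def by (simp add: mult.commute)
  moreover have "(2 * (a + b)) * (inverse d / 2) = (a + b) / d"
    using d by (simp add: field_simps)
  ultimately have "((\<lambda>t. vdist P (w t) i j) has_real_derivative (a + b) / d) (at t within S)"
    by metis
  moreover have "(Vpot P i j has_real_derivative deriv (Vpot P i j) d) (at d)"
    by (rule C1_differentiable_on_has_deriv[OF couplings(7)[OF ij]]) (use OmegaD(10)[OF w(2) ij] in \<open>auto simp: d_def\<close>)
  ultimately have "((\<lambda>t. Vpot P i j (vdist P (w t) i j)) has_real_derivative
      deriv (Vpot P i j) d * ((a + b) / d)) (at t within S)"
    unfolding d_def by (rule DERIV_chain2[rotated])
  moreover have "deriv (Vpot P i j) d * ((a + b) / d) = pair_slope (w t) D i j + pair_slope (w t) D j i"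
    unfolding pair_slope_def vdist_commute[OF ij, symmetric]
      deriv_Vpot_commute[OF w(2) ij, unfolded vdist_commute[OF ij, symmetric], folded d_def] d_def[symmetric]
      couplings(1)[OF ij, symmetric] a_def[symmetric] b_def[symmetric]
    by (simp add: add_divide_distrib distrib_left)
  ultimately show ?thesis by simp
qed

text \<open>
The derivative of each pair potential splits into the contributions of the two vehicles; exchanging the
summation indices collects with every vehicle all contributions of its own velocity.
\<close>

lemma H_R_has_derivative:
  assumes w: "(w has_vector_derivative D) (at t within S)" "w t \<in> Omega P"
  shows "((\<lambda>t. H_R P (w t)) has_real_derivative lyap_slope P (w t) D) (at t within S)"
proof -
  note st = component_has_derivative[OF w(1)]
  note O = OmegaD[OF w(2)]
  define r s v y where rsvy: "r i = st_r (w t) i" "s i = st_s (w t) i" "v i = st_v (w t) i"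
    "y i = ang_speed (w t) i - omega P" for i
  define K where "K i = (y i * q_fun P (r i) (s i) (v i) + zeta_fun P (s i) (v i) * v i * sin (s i)) * st_v D i
         + (v i * cos (s i) / (vmax P - v i) * (bcoef P - 1 / (r i)\<^sup>2)
            + omega P / (r i * (vmax P - v i))) * sin (s i) * st_s D i
         - y i * (cos (s i) / ((vmax P - v i) * (r i)\<^sup>2)) * st_r D i" for i
  define A where "A i = sin (s i) / (cos (s i) - cos (Theta P))\<^sup>2 * st_s D i" for i
  define U where "U i = deriv (Upot P i) (r i) * st_r D i" for i
  have dK: "((\<lambda>t. ((ang_speed (w t) i - omega P)\<^sup>2 + bcoef P * (st_v (w t) i)\<^sup>2 * (sin (st_s (w t) i))\<^sup>2)
                     / ((vmax P - st_v (w t) i) * st_v (w t) i)) has_real_derivative 2 * K i) (at t within S)" for i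
    using kinetic_has_derivative[OF st(1)[of i] st(3)[of i] st(4)[of i], of P] O[of i]
    unfolding K_def rsvy ang_speed_def by simp
  have dA: "((\<lambda>t. 1 / (cos (st_s (w t) i) - cos (Theta P)) - 1 / (1 - cos (Theta P)))
      has_real_derivative A i) (at t within S)" for i
    unfolding A_def rsvy using O(8)[of i]
    by (auto intro!: derivative_eq_intros st simp: power2_eq_square)
  have dU: "((\<lambda>t. Upot P i (st_r (w t) i)) has_real_derivative U i) (at t within S)" for i
    unfolding U_def rsvy using O[of i]
    by (intro DERIV_chain2[OF _ st(1)] C1_differentiable_on_has_deriv[OF road_potential(2)]) auto
  have dH: "((\<lambda>t. H_R P (w t)) has_real_derivative
      1/2 * (\<Sum>i\<in>UNIV. 2 * K i) + (\<Sum>i\<in>UNIV. U i)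
      + 1/2 * (\<Sum>i\<in>UNIV. \<Sum>j\<in>UNIV - {i}. pair_slope (w t) D i j + pair_slope (w t) D j i)
      + Acoef P * (\<Sum>i\<in>UNIV. A i)) (at t within S)"
    unfolding H_R_def
    by (intro DERIV_add DERIV_cmult DERIV_sum dK dA dU Vpot_has_derivative w) auto
  have V: "(\<Sum>i\<in>UNIV. \<Sum>j\<in>UNIV - {i}. pair_slope (w t) D i j + pair_slope (w t) D j i)
      = 2 * (\<Sum>i\<in>UNIV. \<Sum>j\<in>UNIV - {i}. pair_slope (w t) D i j)"
    using sum_offdiag_swap[of "pair_slope (w t) D"] by (simp add: sum.distrib)
  have PZ: "(\<Sum>j\<in>UNIV - {i}. pair_slope (w t) D i j)
      = (\<Sum>j\<in>UNIV - {i}.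
          (pcoef P i j * (st_r (w t) i - st_r (w t) j)
             + st_r (w t) j * (1 - cos (st_phi (w t) i - st_phi (w t) j)))
          * (deriv (Vpot P i j) (vdist P (w t) i j) / vdist P (w t) i j)) * st_r D i
        + omega P * Phi_fun P (w t) i * st_phi D i" for i
    unfolding Phi_fun_def pair_slope_def sum_distrib_right sum_distrib_left sum.distrib[symmetric]
    using parameter_bounds by (intro sum.cong refl) (simp add: algebra_simps add_divide_distrib diff_divide_distrib)
  have "K i + U i + (\<Sum>j\<in>UNIV - {i}. pair_slope (w t) D i j) + Acoef P * A i
      = ((ang_speed (w t) i - omega P) * q_fun P (st_r (w t) i) (st_s (w t) i) (st_v (w t) i)
        + zeta_fun P (st_s (w t) i) (st_v (w t) i) * st_v (w t) i * sin (st_s (w t) i)) * st_v D i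
      + gamma_fun P (st_r (w t) i) (st_s (w t) i) (st_v (w t) i) * sin (st_s (w t) i) * st_s D i
      - Z_fun P (w t) i * st_r D i
      + omega P * Phi_fun P (w t) i * st_phi D i" for i
    unfolding PZ K_def U_def A_def rsvy gamma_fun_def Z_fun_def
    by (simp add: ring_distribs)
  then have "lyap_slope P (w t) D
      = (\<Sum>i\<in>UNIV. K i + U i + (\<Sum>j\<in>UNIV - {i}. pair_slope (w t) D i j) + Acoef P * A i)"
    unfolding lyap_slope_def by (intro sum.cong) auto
  with dH show ?thesis
    unfolding V by (simp add: sum.distrib sum_distrib_left)
qed

text \<open>
The angular components of the pair forces are opposite to each other.
\<close>

lemma Phi_sum_zero:
  assumes w: "w \<in> Omega P"
  shows "(\<Sum>i\<in>UNIV. Phi_fun P w i) = 0"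
proof -
  have "(\<Sum>i\<in>UNIV. \<Sum>j\<in>UNIV - {i}. st_r w i / omega P * (deriv (Vpot P i j) (vdist P w i j)
        * (st_r w j * sin (st_phi w i - st_phi w j) / vdist P w i j))) = 0"
  proof (rule sum_offdiag_antisym)
    fix i j :: 'n assume ij: "i \<noteq> j"
    have "sin (st_phi w j - st_phi w i) = - sin (st_phi w i - st_phi w j)"
      by (simp add: sin_diff)
    then show "st_r w j / omega P * (deriv (Vpot P j i) (vdist P w j i)
        * (st_r w i * sin (st_phi w j - st_phi w i) / vdist P w j i))
      = - (st_r w i / omega P * (deriv (Vpot P i j) (vdist P w i j)
        * (st_r w j * sin (st_phi w i - st_phi w j) / vdist P w i j)))"
      using deriv_Vpot_commute[OF w ij] vdist_commute[OF ij] by simp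
  qed
  then show ?thesis unfolding Phi_fun_def sum_distrib_left .
qed

lemma kappa_coupling:
  assumes w: "w \<in> Omega P" and ij: "i \<noteq> j"
  shows "0 \<le> kappa P i j (vdist P w i j)"
    "kappa P i j (vdist P w i j) = kappa P j i (vdist P w j i)"
  using couplings(10,11)[OF ij] OmegaD(10)[OF w ij] vdist_commute[OF ij] by metis+

text \<open>
Substituting the feedback laws for \<open>q F\<close> and for \<open>\<gamma>\<close> times the heading rate, the terms with
\<open>Z\<close> and \<open>\<zeta>\<close> cancel.  The term with \<open>\<Phi>\<close> in the acceleration law reduces the work of the angular
forces, \<open>\<omega> \<Phi>\<^sub>i\<close> times the angular speed, to \<open>\<omega>\<^sup>2 \<Phi>\<^sub>i\<close>, which sums to zero.  The couplings
contribute the consensus sums.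
\<close>

lemma lyap_slope_cruise:
  assumes w: "w \<in> Omega P"
  shows "lyap_slope P w (cruise_field P w)
    \<le> - (\<Sum>i\<in>UNIV. (ang_speed w i - omega P) * f1 P (ang_speed w i - omega P)
         + sin (st_s w i) * f2 P (sin (st_s w i)))"
proof -
  define y sn where "y i = ang_speed w i - omega P" "sn i = sin (st_s w i)" for i
  have rate: "(y i * q_fun P (st_r w i) (st_s w i) (st_v w i)
        + zeta_fun P (st_s w i) (st_v w i) * st_v w i * sn i) * F_law P w i
      + gamma_fun P (st_r w i) (st_s w i) (st_v w i) * sn i * steer_rate P w i
      - Z_fun P w i * (- st_v w i * sn i)
      + omega P * Phi_fun P w i * ang_speed w i
    = - (y i * f1 P (y i) + sn i * f2 P (sn i)) + (omega P)\<^sup>2 * Phi_fun P w i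
      + y i * (omega P * G_fun P w i) + sn i * M_fun P w i" for i
  proof -
    define q g F S where "q = q_fun P (st_r w i) (st_s w i) (st_v w i)"
      "g = gamma_fun P (st_r w i) (st_s w i) (st_v w i)" "F = F_law P w i" "S = steer_rate P w i"
    have qF: "q * F = - (f1 P (y i) + omega P * (Phi_fun P w i - G_fun P w i))"
      unfolding q_g_F_S_def F_law_def y_sn_def using q_pos[OF w, of i] by simp
    have gS: "g * S = - (f2 P (sn i) + (zeta_fun P (st_s w i) (st_v w i) * F + Z_fun P w i) * st_v w i - M_fun P w i)"
      unfolding q_g_F_S_def steer_rate_def y_sn_def using gamma_pos[OF w, of i] by simp
    have a: "ang_speed w i = y i + omega P" by (simp add: y_sn_def)
    have "(y i * q + zeta_fun P (st_s w i) (st_v w i) * st_v w i * sn i) * F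
      + g * sn i * S - Z_fun P w i * (- st_v w i * sn i) + omega P * Phi_fun P w i * ang_speed w i
      = y i * (q * F) + zeta_fun P (st_s w i) (st_v w i) * st_v w i * sn i * F
      + sn i * (g * S) + Z_fun P w i * st_v w i * sn i + omega P * Phi_fun P w i * ang_speed w i"
      by (simp add: algebra_simps)
    also have "\<dots> = - (y i * f1 P (y i) + sn i * f2 P (sn i)) + (omega P)\<^sup>2 * Phi_fun P w i
      + y i * (omega P * G_fun P w i) + sn i * M_fun P w i"
      unfolding qF gS a by (simp add: algebra_simps power2_eq_square)
    finally show ?thesis unfolding q_g_F_S_def .
  qed
  have "lyap_slope P w (cruise_field P w)
      = - (\<Sum>i\<in>UNIV. y i * f1 P (y i) + sn i * f2 P (sn i))
        + (omega P)\<^sup>2 * (\<Sum>i\<in>UNIV. Phi_fun P w i)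
        + (\<Sum>i\<in>UNIV. y i * (omega P * G_fun P w i)) + (\<Sum>i\<in>UNIV. sn i * M_fun P w i)"
    unfolding lyap_slope_def cruise_field_components[OF w] y_sn_def[symmetric] rate sum.distrib
      sum_negf sum_distrib_left ..
  moreover have "(\<Sum>i\<in>UNIV. y i * (omega P * G_fun P w i)) \<le> 0"
  proof -
    have "(\<Sum>i\<in>UNIV. y i * (\<Sum>j\<in>UNIV - {i}. kappa P i j (vdist P w i j)
        * (g1 P (ang_speed w j) - g1 P (ang_speed w i)))) \<le> 0"
      by (rule consensus_sum_nonpos)
        (use kappa_coupling[OF w] monoD[OF feedback_functions(2)] in \<open>auto simp: y_sn_def\<close>)
    then show ?thesis unfolding G_fun_def using parameter_bounds by simp
  qed
  moreover have "(\<Sum>i\<in>UNIV. sn i * M_fun P w i) \<le> 0"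
    unfolding M_fun_def
    by (rule consensus_sum_nonpos)
      (use kappa_coupling[OF w] monoD[OF feedback_functions(4)] in \<open>auto simp: y_sn_def\<close>)
  ultimately show ?thesis unfolding Phi_sum_zero[OF w] y_sn_def by simp
qed

lemma lyap_slope_scaleR: "lyap_slope P w (a *\<^sub>R D) = a * lyap_slope P w D"
  unfolding lyap_slope_def sum_distrib_left
  by (intro sum.cong refl) (simp add: st_r_def st_phi_def st_s_def st_v_def algebra_simps)

lemma dissipation_nonneg:
  "0 \<le> (ang_speed w i - omega P) * f1 P (ang_speed w i - omega P)
     + sin (st_s w i) * f2 P (sin (st_s w i))"
  using damping_nonneg by (intro add_nonneg_nonneg)

text \<open>
The factor \<open>a\<close> allows for fields that are nonnegative multiples of the closed-loop field.
\<close>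

lemma H_R_nonincreasing:
  assumes "0 \<le> T"
    and "\<And>t. t \<in> {0..T} \<Longrightarrow> w t \<in> Omega P"
    and "\<And>t. t \<in> {0..T} \<Longrightarrow> (w has_vector_derivative a t *\<^sub>R cruise_field P (w t)) (at t within {0..T})"
    and "\<And>t. t \<in> {0..T} \<Longrightarrow> 0 \<le> a t"
  shows "H_R P (w T) \<le> H_R P (w 0)"
proof -
  have "H_R P (w T) \<le> H_R P (w 0) + 0 * (T - 0)"
  proof (rule derivative_le_imp_increment_le[OF assms(1), where h="\<lambda>t. H_R P (w t)"])
    fix t assume t: "t \<in> {0..T}"
    show "((\<lambda>t. H_R P (w t)) has_real_derivative a t * lyap_slope P (w t) (cruise_field P (w t)))
        (at t within {0..T})"
      using H_R_has_derivative[of w, OF assms(3)[OF t] assms(2)[OF t]] by (simp add: lyap_slope_scaleR)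
    have "0 \<le> (\<Sum>i\<in>UNIV. (ang_speed (w t) i - omega P) * f1 P (ang_speed (w t) i - omega P)
         + sin (st_s (w t) i) * f2 P (sin (st_s (w t) i)))"
      by (intro sum_nonneg dissipation_nonneg)
    then have "lyap_slope P (w t) (cruise_field P (w t)) \<le> 0"
      using lyap_slope_cruise[OF assms(2)[OF t]] by linarith
    then show "a t * lyap_slope P (w t) (cruise_field P (w t)) \<le> 0"
      using assms(4)[OF t] by (simp add: mult_nonneg_nonpos)
  qed
  then show ?thesis by simp
qed

end

section \<open>Sublevel sets of the Lyapunov function\<close>

definition sublevel :: "'n::finite params \<Rightarrow> real \<Rightarrow> 'n state set" where
  "sublevel P c = {w \<in> Omega P. H_R P w \<le> c}"

lemma filterlim_at_top_at_right_margin: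
  fixes f :: "real \<Rightarrow> real"
  assumes "filterlim f at_top (at_right a)"
  shows "\<exists>e>0. \<forall>x>a. f x \<le> c \<longrightarrow> a + e \<le> x"
proof -
  have "eventually (\<lambda>x. c < f x) (at_right a)"
    using assms by (simp add: filterlim_at_top_dense)
  then obtain b where b: "b > a" "\<And>x. a < x \<Longrightarrow> x < b \<Longrightarrow> c < f x"
    unfolding eventually_at_right_field by blast
  then show ?thesis by (intro exI[of _ "b - a"]) (auto simp: not_less[symmetric])
qed

lemma filterlim_at_top_at_left_margin:
  fixes f :: "real \<Rightarrow> real"
  assumes "filterlim f at_top (at_left a)"
  shows "\<exists>e>0. \<forall>x<a. f x \<le> c \<longrightarrow> x \<le> a - e"
proof -
  have "eventually (\<lambda>x. c < f x) (at_left a)"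
    using assms by (simp add: filterlim_at_top_dense)
  then obtain b where b: "b < a" "\<And>x. b < x \<Longrightarrow> x < a \<Longrightarrow> c < f x"
    unfolding eventually_at_left_field by blast
  then show ?thesis by (intro exI[of _ "a - b"]) (auto simp: not_less[symmetric])
qed

context admissible_params
begin

lemma H_R_terms_nonneg:
  assumes w: "w \<in> Omega P"
  shows "0 \<le> ((ang_speed w i - omega P)\<^sup>2 + bcoef P * (st_v w i)\<^sup>2 * (sin (st_s w i))\<^sup>2)
                     / ((vmax P - st_v w i) * st_v w i)"
    "0 \<le> Upot P i (st_r w i)"
    "j \<in> UNIV - {i} \<Longrightarrow> 0 \<le> Vpot P i j (vdist P w i j)"
    "0 \<le> 1 / (cos (st_s w i) - cos (Theta P)) - 1 / (1 - cos (Theta P))"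
proof -
  note O = OmegaD[OF w]
  have "0 < bcoef P" using less_trans[OF _ parameter_bounds(11)] parameter_bounds(1) by simp
  then show "0 \<le> ((ang_speed w i - omega P)\<^sup>2 + bcoef P * (st_v w i)\<^sup>2 * (sin (st_s w i))\<^sup>2)
                     / ((vmax P - st_v w i) * st_v w i)"
    using O[of i] by (intro divide_nonneg_pos add_nonneg_nonneg mult_nonneg_nonneg mult_pos_pos) auto
  show "0 \<le> Upot P i (st_r w i)" using road_potential(1) O[of i] by auto
  show "0 \<le> Vpot P i j (vdist P w i j)" if "j \<in> UNIV - {i}"
    using couplings(5)[of i j] O(10)[of i j] that by auto
  have "1 / (1 - cos (Theta P)) \<le> 1 / (cos (st_s w i) - cos (Theta P))"
    using O(8)[of i] less_le_trans[OF O(8)[of i] cos_le_one] by (intro divide_left_mono mult_pos_pos) auto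
  then show "0 \<le> 1 / (cos (st_s w i) - cos (Theta P)) - 1 / (1 - cos (Theta P))" by simp
qed

lemma H_R_terms_le:
  assumes w: "w \<in> Omega P"
  shows "((ang_speed w i - omega P)\<^sup>2 + bcoef P * (st_v w i)\<^sup>2 * (sin (st_s w i))\<^sup>2)
                     / ((vmax P - st_v w i) * st_v w i) \<le> 2 * H_R P w"
    "Upot P i (st_r w i) \<le> H_R P w"
    "i \<noteq> j \<Longrightarrow> Vpot P i j (vdist P w i j) \<le> 2 * H_R P w"
    "Acoef P * (1 / (cos (st_s w i) - cos (Theta P)) - 1 / (1 - cos (Theta P))) \<le> H_R P w"
    "0 \<le> H_R P w"
proof -
  note n = H_R_terms_nonneg[OF w]
  define K where "K i = ((ang_speed w i - omega P)\<^sup>2 + bcoef P * (st_v w i)\<^sup>2 * (sin (st_s w i))\<^sup>2)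
                     / ((vmax P - st_v w i) * st_v w i)" for i
  define U where "U i = Upot P i (st_r w i)" for i
  define V where "V i j = Vpot P i j (vdist P w i j)" for i j
  define C where "C i = 1 / (cos (st_s w i) - cos (Theta P)) - 1 / (1 - cos (Theta P))" for i
  have H: "H_R P w = 1/2 * sum K UNIV + sum U UNIV + 1/2 * (\<Sum>i\<in>UNIV. sum (V i) (UNIV - {i}))
      + Acoef P * sum C UNIV"
    unfolding H_R_def K_def U_def V_def C_def ..
  have n': "0 \<le> K i" "0 \<le> U i" "j \<in> UNIV - {i} \<Longrightarrow> 0 \<le> V i j" "0 \<le> C i" for i j
    unfolding K_def U_def V_def C_def by (fact n)+
  have s: "0 \<le> sum K UNIV" "0 \<le> sum U UNIV" "0 \<le> sum (V i) (UNIV - {i})"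
    "0 \<le> (\<Sum>i\<in>UNIV. sum (V i) (UNIV - {i}))" "0 \<le> Acoef P * sum C UNIV" for i
    by (intro sum_nonneg mult_nonneg_nonneg n' less_imp_le[OF parameter_bounds(10)]; assumption)+
  have m: "K i \<le> sum K UNIV" "U i \<le> sum U UNIV" "C i \<le> sum C UNIV"
      "sum (V i) (UNIV - {i}) \<le> (\<Sum>i\<in>UNIV. sum (V i) (UNIV - {i}))" for i
    using n' s(3) by (auto intro!: member_le_sum)
  have mV: "V i j \<le> sum (V i) (UNIV - {i})" if "i \<noteq> j"
    using n'(3) that by (intro member_le_sum) auto
  have mC: "Acoef P * C i \<le> Acoef P * sum C UNIV" using m parameter_bounds by simp
  show "((ang_speed w i - omega P)\<^sup>2 + bcoef P * (st_v w i)\<^sup>2 * (sin (st_s w i))\<^sup>2)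
                     / ((vmax P - st_v w i) * st_v w i) \<le> 2 * H_R P w"
    "Upot P i (st_r w i) \<le> H_R P w"
    "Acoef P * (1 / (cos (st_s w i) - cos (Theta P)) - 1 / (1 - cos (Theta P))) \<le> H_R P w"
    unfolding K_def[symmetric] U_def[symmetric] C_def[symmetric]
    using H s m(1)[of i] m(2)[of i] mC by linarith+
  show "Vpot P i j (vdist P w i j) \<le> 2 * H_R P w" if "i \<noteq> j"
    unfolding V_def[symmetric] using H s m(4)[of i] mV[OF that] by linarith
  show "0 \<le> H_R P w" using H s by linarith
qed

text \<open>
The kinetic term bounds the squared error of the angular speed by a multiple of
\<open>(v\<^sub>m\<^sub>a\<^sub>x - v) v\<close>, which is small near both ends of the speed range.  There the error is not
small: near speed \<open>0\<close> it is close to \<open>- \<omega>\<close>, and near \<open>v\<^sub>m\<^sub>a\<^sub>x\<close> the condition on \<open>\<Theta>\<close> makes the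
angular speed exceed \<open>\<omega>\<close>.
\<close>

lemma sublevel_speed_margin: "\<exists>e>0. \<forall>w \<in> sublevel P c. \<forall>i. st_v w i \<in> {e..vmax P - e}"
proof -
  define k where "k = 2 * (\<bar>c\<bar> + 1) * vmax P"
  have k: "k > 0" using parameter_bounds by (simp add: k_def add_nonneg_pos)
  \<comment> \<open>half of the excess of the smallest possible angular speed at \<open>v\<^sub>m\<^sub>a\<^sub>x\<close> over \<open>\<omega>\<close>\<close>
  define h where "h = (vmax P * cos (Theta P) / Rout P - omega P) / 2"
  have "Rout P * omega P < vmax P * cos (Theta P)" using parameter_bounds by (simp add: field_simps)
  then have h: "h > 0" using parameter_bounds unfolding h_def by (simp add: field_simps)
  have Ro: "Rout P > 0" using parameter_bounds by linarith
  have key: "(ang_speed w i - omega P)\<^sup>2 \<le> k / vmax P * ((vmax P - st_v w i) * st_v w i)"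
    if "w \<in> sublevel P c" for w i
  proof -
    from that have w: "w \<in> Omega P" and c: "H_R P w \<le> c" by (auto simp: sublevel_def)
    have D: "0 < (vmax P - st_v w i) * st_v w i" using OmegaD[OF w, of i] by simp
    have "0 < bcoef P" using less_trans[OF _ parameter_bounds(11)] parameter_bounds(1) by simp
    then have "(ang_speed w i - omega P)\<^sup>2 / ((vmax P - st_v w i) * st_v w i)
        \<le> ((ang_speed w i - omega P)\<^sup>2 + bcoef P * (st_v w i)\<^sup>2 * (sin (st_s w i))\<^sup>2)
                     / ((vmax P - st_v w i) * st_v w i)"
      using D by (intro divide_right_mono) auto
    also have "\<dots> \<le> k / vmax P" using H_R_terms_le(1)[OF w, of i] c parameter_bounds by (simp add: k_def)
    finally show ?thesis using D by (simp add: pos_divide_le_eq)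
  qed
  \<comment> \<open>the first and third bound keep the error of the angular speed above \<open>\<omega> / 2\<close> and \<open>h\<close>; the second and
    fourth then contradict \<open>key\<close>\<close>
  define e where "e = Min {Rin P * omega P / 2, (omega P)\<^sup>2 / (4 * k), h * Rout P / cos (Theta P), h\<^sup>2 / k}"
  have e: "e \<le> Rin P * omega P / 2" "e \<le> (omega P)\<^sup>2 / (4 * k)" "e \<le> h * Rout P / cos (Theta P)" "e \<le> h\<^sup>2 / k"
    unfolding e_def by (rule Min_le; simp)+
  have e0: "e > 0" unfolding e_def using parameter_bounds k h Ro cos_Theta by auto
  have "st_v w i \<in> {e..vmax P - e}" if K: "w \<in> sublevel P c" for w i
  proof -
    from K have w: "w \<in> Omega P" by (auto simp: sublevel_def)
    define v r where "v = st_v w i" "r = st_r w i"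
    note O = OmegaD[OF w, of i, folded v_r_def]
    have 1: "e \<le> v"
    proof (rule ccontr)
      assume "\<not> e \<le> v"
      then have v: "v < e" by simp
      have "ang_speed w i \<le> v / r * 1"
        unfolding ang_speed_def v_r_def[symmetric] using O by (intro mult_left_mono) auto
      also have "\<dots> \<le> v / Rin P" using O parameter_bounds by (simp add: frac_le)
      also have "\<dots> \<le> omega P / 2" using v e(1) parameter_bounds by (simp add: field_simps)
      finally have "omega P / 2 \<le> \<bar>ang_speed w i - omega P\<bar>" by linarith
      then have "(omega P / 2)\<^sup>2 \<le> (ang_speed w i - omega P)\<^sup>2"
        using parameter_bounds by (metis abs_ge_zero abs_le_square_iff abs_of_nonneg divide_nonneg_nonneg less_imp_le zero_le_numeral)
      also have "\<dots> \<le> k / vmax P * ((vmax P - v) * v)" using key[OF K] by (simp add: v_r_def)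
      also have "\<dots> \<le> k / vmax P * (vmax P * v)" using O k parameter_bounds by (intro mult_left_mono mult_right_mono) auto
      also have "\<dots> = k * v" using parameter_bounds by simp
      also have "\<dots> < k * e" using v k by simp
      also have "\<dots> \<le> k * ((omega P)\<^sup>2 / (4 * k))" using e(2) k by (intro mult_left_mono) auto
      also have "\<dots> = (omega P / 2)\<^sup>2" using k by (simp add: power2_eq_square)
      finally show False by simp
    qed
    have 2: "v \<le> vmax P - e"
    proof (rule ccontr)
      assume "\<not> v \<le> vmax P - e"
      then have v: "vmax P - v < e" by simp
      have "(vmax P - v) * cos (Theta P) / Rout P \<le> (h * Rout P / cos (Theta P)) * cos (Theta P) / Rout P"
        using v e(3) cos_Theta Ro by (intro divide_right_mono mult_right_mono) auto
      also have "\<dots> = h" using cos_Theta Ro by simp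
      finally have "2 * h - h \<le> v * cos (Theta P) / Rout P - omega P"
        unfolding h_def by (simp add: left_diff_distrib diff_divide_distrib)
      also have "v * cos (Theta P) / Rout P \<le> v / r * cos (st_s w i)"
        using O cos_Theta Ro mult_mono[of "v / Rout P" "v / r" "cos (Theta P)" "cos (st_s w i)"]
        by (simp add: frac_le)
      finally have "h \<le> \<bar>ang_speed w i - omega P\<bar>" unfolding ang_speed_def v_r_def by linarith
      then have "h\<^sup>2 \<le> (ang_speed w i - omega P)\<^sup>2"
        using h by (simp add: abs_le_square_iff[symmetric])
      also have "\<dots> \<le> k / vmax P * ((vmax P - v) * v)" using key[OF K] by (simp add: v_r_def)
      also have "\<dots> \<le> k / vmax P * ((vmax P - v) * vmax P)" using O k parameter_bounds by (intro mult_left_mono) auto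
      also have "\<dots> = k * (vmax P - v)" using parameter_bounds by simp
      also have "\<dots> < k * e" using v k by simp
      also have "\<dots> \<le> k * (h\<^sup>2 / k)" using e(4) k by (intro mult_left_mono) auto
      also have "\<dots> = h\<^sup>2" using k by simp
      finally show False by simp
    qed
    show ?thesis using 1 2 by (simp add: v_r_def)
  qed
  then show ?thesis using e0 by blast
qed

lemma sublevel_heading_margin: "\<exists>e>0. \<forall>w \<in> sublevel P c. \<forall>i. cos (Theta P) + e \<le> cos (st_s w i)"
proof -
  define k where "k = (\<bar>c\<bar> + 1) / Acoef P + 1 / (1 - cos (Theta P))"
  have T: "cos (Theta P) < 1"
    using less_le_trans[OF cos_gt_cos_Theta[of 0] cos_le_one] parameter_bounds by simp
  have "\<bar>c\<bar> + 1 > 0" by linarith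
  then have k: "k > 0" unfolding k_def using parameter_bounds T
    by (intro add_pos_pos[OF divide_pos_pos divide_pos_pos]) auto
  have "cos (Theta P) + 1 / k \<le> cos (st_s w i)" if "w \<in> sublevel P c" for w i
  proof -
    from that have w: "w \<in> Omega P" and c: "H_R P w \<le> c" by (auto simp: sublevel_def)
    have "Acoef P * (1 / (cos (st_s w i) - cos (Theta P)) - 1 / (1 - cos (Theta P))) \<le> \<bar>c\<bar> + 1"
      using H_R_terms_le(4)[OF w, of i] c by linarith
    then have "1 / (cos (st_s w i) - cos (Theta P)) - 1 / (1 - cos (Theta P)) \<le> (\<bar>c\<bar> + 1) / Acoef P"
      using parameter_bounds by (simp add: pos_le_divide_eq mult.commute)
    then have "1 / (cos (st_s w i) - cos (Theta P)) \<le> k" by (simp add: k_def)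
    then have "1 / k \<le> cos (st_s w i) - cos (Theta P)"
      using k OmegaD(8)[OF w, of i] by (simp add: field_simps)
    then show ?thesis by simp
  qed
  then show ?thesis using k by (intro exI[of _ "1/k"]) auto
qed

text \<open>
On the sublevel set every constraint defining \<^const>\<open>Omega\<close> holds with a positive margin.  The
constraints with margin define a closed set \<open>B\<close> inside \<^const>\<open>Omega\<close>, on which \<^const>\<open>H_R\<close> is
continuous.
\<close>

lemma closed_sublevel: "closed (sublevel P c)"
proof -
  obtain ev where ev: "ev > 0" "\<And>w i. w \<in> sublevel P c \<Longrightarrow> st_v w i \<in> {ev..vmax P - ev}"
    using sublevel_speed_margin by blast
  obtain es where es: "es > 0" "\<And>w i. w \<in> sublevel P c \<Longrightarrow> cos (Theta P) + es \<le> cos (st_s w i)"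
    using sublevel_heading_margin by blast
  have "\<forall>i. \<exists>e>0. \<forall>x > Rin P. Upot P i x \<le> c \<longrightarrow> Rin P + e \<le> x"
    using filterlim_at_top_at_right_margin[OF road_potential(4)] by blast
  then obtain el where el: "\<And>i. el i > 0" "\<And>i x. x > Rin P \<Longrightarrow> Upot P i x \<le> c \<Longrightarrow> Rin P + el i \<le> x"
    by metis
  have "\<forall>i. \<exists>e>0. \<forall>x < Rout P. Upot P i x \<le> c \<longrightarrow> x \<le> Rout P - e"
    using filterlim_at_top_at_left_margin[OF road_potential(5)] by blast
  then obtain er where er: "\<And>i. er i > 0" "\<And>i x. x < Rout P \<Longrightarrow> Upot P i x \<le> c \<Longrightarrow> x \<le> Rout P - er i"
    by metis
  have "\<forall>i j. \<exists>e>0. i \<noteq> j \<longrightarrow> (\<forall>x > Lmin P i j. Vpot P i j x \<le> 2 * c \<longrightarrow> Lmin P i j + e \<le> x)"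
    using filterlim_at_top_at_right_margin[OF couplings(9)] by (metis zero_less_one)
  then obtain ed where ed: "\<And>i j. ed i j > 0"
    "\<And>i j x. i \<noteq> j \<Longrightarrow> x > Lmin P i j \<Longrightarrow> Vpot P i j x \<le> 2 * c \<Longrightarrow> Lmin P i j + ed i j \<le> x"
    by metis
  define B where "B = (\<Inter>i. ({w. Rin P + el i \<le> st_r w i} \<inter> {w. st_r w i \<le> Rout P - er i})
      \<inter> ({w. - Theta P \<le> st_s w i} \<inter> {w. st_s w i \<le> Theta P} \<inter> {w. cos (Theta P) + es \<le> cos (st_s w i)})
      \<inter> ({w. ev \<le> st_v w i} \<inter> {w. st_v w i \<le> vmax P - ev})
      \<inter> (\<Inter>j\<in>UNIV - {i}. {w. Lmin P i j + ed i j \<le> vdist P w i j}))"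
  have c: "continuous_on UNIV (\<lambda>w::'n state. st_r w i)" "continuous_on UNIV (\<lambda>w::'n state. st_s w i)"
    "continuous_on UNIV (\<lambda>w::'n state. st_v w i)" "continuous_on UNIV (\<lambda>w::'n state. st_phi w i)" for i
    by (auto intro!: linear_continuous_on component_bounded_linear)
  have d: "continuous_on UNIV (\<lambda>w. vdist P w i j)" for i j
    unfolding vdist_def by (intro continuous_intros c)
  have clB: "closed B"
    unfolding B_def by (intro closed_INT closed_Int ballI closed_Collect_le c d continuous_intros)
  have BO: "B \<subseteq> Omega P"
  proof
    fix w assume w: "w \<in> B"
    have "st_r w i \<in> {Rin P <..< Rout P}" "st_v w i \<in> {0 <..< vmax P}" for i
    proof -
      have "Rin P + el i \<le> st_r w i" "st_r w i \<le> Rout P - er i" "ev \<le> st_v w i" "st_v w i \<le> vmax P - ev"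
        using w unfolding B_def by auto
      then show "st_r w i \<in> {Rin P <..< Rout P}" "st_v w i \<in> {0 <..< vmax P}"
        using el(1)[of i] er(1)[of i] ev(1) by auto
    qed
    moreover have "st_s w i \<in> {- Theta P <..< Theta P}" for i
    proof -
      have s: "- Theta P \<le> st_s w i" "st_s w i \<le> Theta P" "cos (Theta P) + es \<le> cos (st_s w i)"
        using w unfolding B_def by auto
      have "st_s w i \<noteq> Theta P" "st_s w i \<noteq> - Theta P" using s(3) es(1) by auto
      then show ?thesis using s by auto
    qed
    moreover have "Lmin P i j < vdist P w i j" if "j \<noteq> i" for i j
    proof -
      have "Lmin P i j + ed i j \<le> vdist P w i j" using w that unfolding B_def by auto
      then show ?thesis using ed(1)[of i j] by linarith
    qed
    ultimately show "w \<in> Omega P" unfolding Omega_def by auto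
  qed
  have KB: "sublevel P c \<subseteq> B"
  proof
    fix w assume K: "w \<in> sublevel P c"
    then have w: "w \<in> Omega P" and h: "H_R P w \<le> c" by (auto simp: sublevel_def)
    note O = OmegaD[OF w]
    have U: "Upot P i (st_r w i) \<le> c" for i using H_R_terms_le(2)[OF w, of i] h by linarith
    have V: "Vpot P i j (vdist P w i j) \<le> 2 * c" if "i \<noteq> j" for i j
      using H_R_terms_le(3)[OF w that] h by linarith
    have "Rin P + el i \<le> st_r w i" "st_r w i \<le> Rout P - er i" for i
      using el(2) er(2) O U by auto
    moreover have "ev \<le> st_v w i" "st_v w i \<le> vmax P - ev" "cos (Theta P) + es \<le> cos (st_s w i)" for i
      using ev(2)[OF K, of i] es(2)[OF K, of i] by auto
    moreover have "- Theta P \<le> st_s w i" "st_s w i \<le> Theta P" for i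
      using O(4,5)[of i] by (auto intro: less_imp_le)
    moreover have "Lmin P i j + ed i j \<le> vdist P w i j" if "j \<noteq> i" for i j
      using ed(2)[OF _ O(10) V, of i j] that by auto
    ultimately show "w \<in> B" unfolding B_def by auto
  qed
  have "continuous_on B (H_R P)"
    by (intro continuous_at_imp_continuous_on ballI lipschitz_near_imp_isCont lipschitz_near_H_R) (use BO in auto)
  then have "closed (B \<inter> H_R P -` {..c})"
    by (intro continuous_closed_preimage clB closed_atMost)
  also have "B \<inter> H_R P -` {..c} = sublevel P c"
    using KB BO by (auto simp: sublevel_def)
  finally show ?thesis .
qed

text \<open>
A compact part of the sublevel set into which full turns move every other point of it.
\<close>

definition period_cell :: "real \<Rightarrow> 'n state set" where
  "period_cell c = sublevel P c \<inter> {w. \<forall>i. st_phi w i \<in> {0..2*pi}}"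

lemma compact_period_cell: "compact (period_cell c)"
proof -
  have "{w::'n state. \<forall>i. st_phi w i \<in> {0..2*pi}}
      = (\<Inter>i. {w. 0 \<le> st_phi w i} \<inter> {w. st_phi w i \<le> 2*pi})" by auto
  also have "closed \<dots>"
    by (intro closed_INT closed_Int ballI closed_Collect_le linear_continuous_on component_bounded_linear continuous_intros)
  finally have "closed (period_cell c)"
    unfolding period_cell_def using closed_sublevel by (intro closed_Int)
  moreover have "bounded (period_cell c)"
  proof (rule bounded_subset)
    let ?R = "cbox (\<chi> i::'n. Rin P) (\<chi> i. Rout P)" and ?F = "cbox (\<chi> i::'n. (0::real)) (\<chi> i. 2*pi)"
    let ?S = "cbox (\<chi> i::'n. - Theta P) (\<chi> i. Theta P)" and ?V = "cbox (\<chi> i::'n. (0::real)) (\<chi> i. vmax P)"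
    show "bounded (?R \<times> ?F \<times> ?S \<times> ?V)"
      by (intro bounded_Times bounded_cbox)
    show "period_cell c \<subseteq> ?R \<times> ?F \<times> ?S \<times> ?V"
      by (auto simp: period_cell_def sublevel_def mem_box_cart Omega_def st_r_def st_phi_def st_s_def st_v_def
          less_imp_le)
  qed
  ultimately show ?thesis by (simp add: compact_eq_bounded_closed)
qed

lemma turn_into_cell:
  assumes "w \<in> sublevel P c" shows "\<exists>k. w + turn k \<in> period_cell c"
  using turn_into_period[of w] assms
  unfolding period_cell_def sublevel_def by (auto simp: turn_invariant_closed_loop simp del: turn_simps(4))

lemma sublevel_lipschitz:
  fixes f :: "'n state \<Rightarrow> 'b::metric_space"
  assumes "\<And>w. w \<in> Omega P \<Longrightarrow> lipschitz_near f w" "\<And>w k. f (w + turn k) = f w"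
  shows "\<exists>d>0. \<exists>L\<ge>0. \<forall>x\<in>sublevel P c. \<forall>y. dist x y < d \<longrightarrow> dist (f x) (f y) \<le> L * dist x y"
proof (rule periodic_lipschitz_uniform[OF compact_period_cell])
  show "\<exists>g. x + g \<in> period_cell c \<and> (\<forall>y. f (y + g) = f y)" if "x \<in> sublevel P c" for x
    using turn_into_cell[OF that] assms(2) by blast
  show "lipschitz_near f x" if "x \<in> period_cell c" for x
    using that assms(1) by (auto simp: period_cell_def sublevel_def)
qed

lemma sublevel_bounded:
  fixes f :: "'n state \<Rightarrow> 'b::metric_space"
  assumes "\<And>w. w \<in> Omega P \<Longrightarrow> lipschitz_near f w" "\<And>w k. f (w + turn k) = f w"
  shows "bounded (f ` sublevel P c)"
proof (rule periodic_bounded[OF compact_period_cell])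
  show "\<exists>g. x + g \<in> period_cell c \<and> (\<forall>y. f (y + g) = f y)" if "x \<in> sublevel P c" for x
    using turn_into_cell[OF that] assms(2) by blast
  show "lipschitz_near f x" if "x \<in> period_cell c" for x
    using that assms(1) by (auto simp: period_cell_def sublevel_def)
qed

text \<open>
The bound is the supremum over the sublevel set.  Inserting \<open>0\<close> keeps the supremum
meaningful, and the function monotone, at levels whose sublevel set is empty.
\<close>

lemma F_law_bound:
  "\<exists>B. mono_on {0..} B \<and> (\<forall>x\<ge>0. 0 \<le> B x) \<and>
     (\<forall>c\<ge>0. \<forall>w \<in> sublevel P c. \<forall>i. \<bar>F_law P w i\<bar> \<le> (B c :: real))"
proof -
  define X where "X c = insert 0 (\<Union>i. (\<lambda>w. \<bar>F_law P w i\<bar>) ` sublevel P c)" for c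
  have "bounded (\<Union>i. (\<lambda>w. \<bar>F_law P w i\<bar>) ` sublevel P c)" for c
  proof (rule bounded_UN)
    show "\<forall>i\<in>UNIV. bounded ((\<lambda>w. \<bar>F_law P w i\<bar>) ` sublevel P c)"
    proof
      fix i
      have "bounded ((\<lambda>w. F_law P w i) ` sublevel P c)"
        by (rule sublevel_bounded) (auto intro: lipschitz_near_closed_loop simp: turn_invariant_closed_loop)
      then show "bounded ((\<lambda>w. \<bar>F_law P w i\<bar>) ` sublevel P c)"
        unfolding bounded_iff by auto
    qed
  qed simp
  then have bdd: "bdd_above (X c)" for c
    unfolding X_def by (simp add: bounded_imp_bdd_above)
  have "mono_on {0..} (\<lambda>c. Sup (X c))"
  proof (rule mono_onI)
    fix a b :: real assume "a \<le> b"
    then have "X a \<subseteq> X b" by (auto simp: X_def sublevel_def)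
    then show "Sup (X a) \<le> Sup (X b)"
      using bdd by (intro cSup_subset_mono) (auto simp: X_def)
  qed
  moreover have "0 \<le> Sup (X c)" for c by (rule cSup_upper[OF _ bdd]) (simp add: X_def)
  moreover have "\<bar>F_law P w i\<bar> \<le> Sup (X c)" if "w \<in> sublevel P c" for w i c
    by (rule cSup_upper[OF _ bdd]) (use that in \<open>auto simp: X_def\<close>)
  ultimately show ?thesis by blast
qed

section \<open>Global existence and uniqueness\<close>

text \<open>
The closed-loop field slowed down by a factor that is \<open>1\<close> where \<^const>\<open>H_R\<close> is at most \<open>c\<close> and
\<open>0\<close> where it is at least \<open>c + 1\<close>; this makes the extension by zero to the whole space Lipschitz.
\<close>

definition cutoff_field :: "real \<Rightarrow> 'n state \<Rightarrow> 'n state" where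
  "cutoff_field c w =
    (if w \<in> Omega P then max 0 (min 1 (c + 1 - H_R P w)) *\<^sub>R cruise_field P w else 0)"

lemma cutoff_field_eq: "w \<in> sublevel P c \<Longrightarrow> cutoff_field c w = cruise_field P w"
  by (simp add: cutoff_field_def sublevel_def)

lemma cutoff_field_zero: "w \<notin> sublevel P (c + 1) \<Longrightarrow> cutoff_field c w = 0"
  by (auto simp: cutoff_field_def sublevel_def max_def min_def)

lemma lipschitz_near_cutoff: "lipschitz_near (cutoff_field c) w"
proof (cases "w \<in> Omega P")
  case True
  have "1-lipschitz_on UNIV (\<lambda>h::real. max 0 (min 1 (c + 1 - h)))"
    by (rule lipschitz_onI) (auto simp: dist_real_def max_def min_def)
  then have "lipschitz_near (\<lambda>h::real. max 0 (min 1 (c + 1 - h))) h" for h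
    unfolding lipschitz_near_def using lipschitz_on_subset zero_less_one by blast
  then have "lipschitz_near (\<lambda>w. max 0 (min 1 (c + 1 - H_R P w))) w"
    by (intro lipschitz_near_compose[OF lipschitz_near_H_R[OF True]])
  then have "lipschitz_near (\<lambda>w. max 0 (min 1 (c + 1 - H_R P w)) *\<^sub>R cruise_field P w) w"
    by (intro lipschitz_near_scaleR lipschitz_near_cruise_field True)
  then show ?thesis
    by (rule lipschitz_near_cong[OF _ open_Omega True]) (simp add: cutoff_field_def)
next
  case False
  have "open (- sublevel P (c + 1))" using closed_sublevel by (simp add: open_Compl)
  moreover have "w \<in> - sublevel P (c + 1)" using False by (simp add: sublevel_def)
  ultimately show ?thesis
    by (rule lipschitz_near_cong[OF lipschitz_near_const[of 0]]) (simp add: cutoff_field_zero)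
qed

lemma cutoff_field_turn: "cutoff_field c (w + turn k) = cutoff_field c w"
  by (simp add: cutoff_field_def turn_invariant_closed_loop cruise_field_turn)

lemma cutoff_field_bounded: "bounded (range (cutoff_field c))"
proof (rule bounded_subset)
  show "bounded (insert 0 (cutoff_field c ` sublevel P (c + 1)))"
    using sublevel_bounded[of "cutoff_field c"] lipschitz_near_cutoff cutoff_field_turn by simp
  show "range (cutoff_field c) \<subseteq> insert 0 (cutoff_field c ` sublevel P (c + 1))"
    using cutoff_field_zero by blast
qed

text \<open>
Pairs of nearby points that meet the sublevel set obey the uniform local estimate, other nearby pairs
are mapped to zero, and for distant pairs boundedness suffices.
\<close>

lemma cutoff_field_lipschitz: "\<exists>L. L-lipschitz_on UNIV (cutoff_field c)"
proof -
  obtain d L where d: "d > 0" and L: "L \<ge> 0"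
    and near: "\<And>x y. x \<in> sublevel P (c + 1) \<Longrightarrow> dist x y < d \<Longrightarrow>
      dist (cutoff_field c x) (cutoff_field c y) \<le> L * dist x y"
    using sublevel_lipschitz[of "cutoff_field c" "c + 1"] lipschitz_near_cutoff cutoff_field_turn by metis
  obtain M where M: "\<And>x. norm (cutoff_field c x) \<le> M"
    using cutoff_field_bounded unfolding bounded_iff by blast
  have M0: "0 \<le> M" using M[of 0] norm_ge_zero order_trans by blast
  have "(L + 2 * M / d)-lipschitz_on UNIV (cutoff_field c)"
  proof (rule lipschitz_onI)
    show "0 \<le> L + 2 * M / d" using L M0 d by simp
    fix x y
    have one: "dist (cutoff_field c x) (cutoff_field c y) \<le> L * dist x y" if "dist x y < d"
    proof (cases "x \<in> sublevel P (c + 1)")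
      case True then show ?thesis using near that by blast
    next
      case x: False
      show ?thesis
      proof (cases "y \<in> sublevel P (c + 1)")
        case True then show ?thesis using near[of y x] that by (simp add: dist_commute)
      next
        case False then show ?thesis using x L by (simp add: cutoff_field_zero)
      qed
    qed
    show "dist (cutoff_field c x) (cutoff_field c y) \<le> (L + 2 * M / d) * dist x y"
    proof (cases "dist x y < d")
      case True
      have "0 \<le> 2 * M / d * dist x y" using M0 d by simp
      then show ?thesis using one[OF True] by (simp add: distrib_right)
    next
      case False
      have "dist (cutoff_field c x) (cutoff_field c y) \<le> 2 * M"
        using norm_triangle_ineq4[of "cutoff_field c x" "cutoff_field c y"] M[of x] M[of y]
        by (simp add: dist_norm)
      also have "\<dots> \<le> 2 * M / d * dist x y"
        using False d M0 mult_left_mono[of d "dist x y" "2 * M / d"] by simp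
      finally show ?thesis using L by (simp add: distrib_right add_increasing)
    qed
  qed
  then show ?thesis ..
qed

lemma solves_ivp_stays:
  assumes sol: "solves_ivp P w0 J w" and J: "{0..T} \<subseteq> J" and T: "0 \<le> T"
  shows "w T \<in> sublevel P (H_R P w0)"
proof -
  have w: "w 0 = w0" "\<And>t. t \<in> {0..T} \<Longrightarrow> w t \<in> Omega P"
    "\<And>t. t \<in> {0..T} \<Longrightarrow> (w has_vector_derivative cruise_field P (w t)) (at t within {0..T})"
    using sol J has_vector_derivative_within_subset[OF _ J, of w] unfolding solves_ivp_def cruise_field_def
    by blast+
  have "H_R P (w T) \<le> H_R P (w 0)"
    by (rule H_R_nonincreasing[where a="\<lambda>_. 1"]) (use w T in auto)
  then show ?thesis using w T by (auto simp: sublevel_def)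
qed

text \<open>
A solution for the cut-off field exists for all times.  Before its first exit from \<^const>\<open>Omega\<close> it
stays in the initial sublevel set, and since that set is closed and contained in \<^const>\<open>Omega\<close>, there
is no such exit.
\<close>

lemma global_solution:
  assumes w0: "w0 \<in> Omega P"
  shows "\<exists>w. solves_ivp P w0 {0..} w"
proof -
  define c where "c = H_R P w0"
  obtain L where L: "L-lipschitz_on UNIV (cutoff_field c)" using cutoff_field_lipschitz by blast
  obtain x where x0: "x 0 = w0"
    and x: "\<And>t. t \<ge> 0 \<Longrightarrow> (x has_vector_derivative cutoff_field c (x t)) (at t within {0..})"
    using lipschitz_ode_exists[OF L cutoff_field_bounded] by blast
  have cx: "continuous_on {0..} x"
    using x by (meson atLeast_iff continuous_on_eq_continuous_within has_vector_derivative_continuous)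
  have stay: "x T \<in> sublevel P c" if T: "T \<ge> 0" and O: "\<And>t. t \<in> {0..T} \<Longrightarrow> x t \<in> Omega P" for T
  proof -
    have "H_R P (x T) \<le> H_R P (x 0)"
    proof (rule H_R_nonincreasing[OF T O, where a="\<lambda>t. max 0 (min 1 (c + 1 - H_R P (x t)))"])
      fix t assume t: "t \<in> {0..T}"
      have "(x has_vector_derivative cutoff_field c (x t)) (at t within {0..T})"
        using t by (intro has_vector_derivative_within_subset[OF x]) auto
      then show "(x has_vector_derivative max 0 (min 1 (c + 1 - H_R P (x t))) *\<^sub>R cruise_field P (x t))
          (at t within {0..T})"
        using O[OF t] by (simp add: cutoff_field_def)
    qed auto
    then show ?thesis using O[of T] T by (simp add: sublevel_def c_def x0)
  qed
  have Om: "x T \<in> Omega P" if T: "T \<ge> 0" for T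
  proof (rule ccontr)
    assume neg: "x T \<notin> Omega P"
    define E where "E = {0..T} \<inter> x -` (- Omega P)"
    have cT: "continuous_on {0..b} x" for b by (rule continuous_on_subset[OF cx]) auto
    have "closed E" unfolding E_def
      by (intro continuous_closed_preimage cT) (auto simp: open_Omega closed_Compl)
    then have "compact ({0..T} \<inter> E)" by (intro compact_Int_closed compact_Icc)
    moreover have "{0..T} \<inter> E = E" by (auto simp: E_def)
    ultimately have "compact E" by simp
    moreover have "E \<noteq> {}" using neg T by (auto simp: E_def)
    ultimately obtain t where t: "t \<in> E" "\<And>s. s \<in> E \<Longrightarrow> t \<le> s"
      using compact_attains_inf[of E] by blast
    have t0: "t > 0" using t(1) w0 x0 by (cases "t = 0") (auto simp: E_def)
    have "{0..<t} \<subseteq> {0..t} \<inter> x -` sublevel P c"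
    proof
      fix s assume s: "s \<in> {0..<t}"
      have "x r \<in> Omega P" if "r \<in> {0..s}" for r
        using t s that by (force simp: E_def)
      then show "s \<in> {0..t} \<inter> x -` sublevel P c" using stay[of s] s by auto
    qed
    moreover have "closed ({0..t} \<inter> x -` sublevel P c)"
      by (intro continuous_closed_preimage cT closed_sublevel) auto
    ultimately have "closure {0..<t} \<subseteq> {0..t} \<inter> x -` sublevel P c"
      by (rule closure_minimal)
    moreover have "t \<in> closure {0..<t}" using t0 by simp
    ultimately have "x t \<in> sublevel P c" by blast
    then show False using t(1) by (simp add: E_def sublevel_def)
  qed
  have "solves_ivp P w0 {0..} x"
    unfolding solves_ivp_def
  proof (intro conjI ballI x0)
    fix t :: real assume t: "t \<in> {0..}"
    show "x t \<in> Omega P" using Om t by simp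
    have "x t \<in> sublevel P c" using stay Om t by simp
    then show "(x has_vector_derivative vehicle_field P (F_law P (x t)) (delta_law P (x t)) (x t))
        (at t within {0..})"
      using x[of t] t by (simp add: cutoff_field_eq cruise_field_def)
  qed
  then show ?thesis by blast
qed

text \<open>
Both solutions stay in the initial sublevel set, where they solve the same globally Lipschitz equation.
\<close>

lemma solution_unique:
  assumes u: "solves_ivp P w0 J u" "{0..T} \<subseteq> J" and w: "solves_ivp P w0 J' w" "{0..T} \<subseteq> J'"
    and T: "0 \<le> T"
  shows "u T = w T"
proof -
  define c where "c = H_R P w0"
  obtain L where L: "L-lipschitz_on UNIV (cutoff_field c)" using cutoff_field_lipschitz by blast
  have der: "(v has_vector_derivative cutoff_field c (v t)) (at t within {0..T})"
    if v: "solves_ivp P w0 I v" "{0..T} \<subseteq> I" and t: "t \<in> {0..T}" for v I t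
  proof -
    have "v t \<in> sublevel P c"
      unfolding c_def by (rule solves_ivp_stays[OF v(1)]) (use v(2) t in auto)
    then show ?thesis
      using v t unfolding solves_ivp_def cutoff_field_eq cruise_field_def
      by (metis has_vector_derivative_within_subset subset_iff cutoff_field_eq cruise_field_def)
  qed
  show ?thesis
    by (rule lipschitz_ode_unique[OF L _ der[OF u] _ der[OF w] _ T])
      (use u w in \<open>auto simp: solves_ivp_def\<close>)
qed

section \<open>Asymptotics of a solution\<close>

lemma ang_speed_bound:
  assumes "x \<in> Omega P" shows "\<bar>ang_speed x i - omega P\<bar> \<le> vmax P / Rin P + omega P"
proof -
  note O = OmegaD[OF assms, of i]
  have "ang_speed x i \<le> st_v x i / st_r x i * 1"
    unfolding ang_speed_def using O by (intro mult_left_mono) auto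
  also have "\<dots> \<le> vmax P / Rin P" using O parameter_bounds by (simp add: frac_le)
  finally have "ang_speed x i \<le> vmax P / Rin P" .
  moreover have "0 \<le> ang_speed x i" unfolding ang_speed_def using O by simp
  ultimately show ?thesis using parameter_bounds by (auto simp: abs_le_iff)
qed

text \<open>
The rate of change of the angular speed along the closed loop.
\<close>

definition ang_rate :: "'n state \<Rightarrow> 'n \<Rightarrow> real" where
  "ang_rate x i = F_law P x i * cos (st_s x i) / st_r x i
     - st_v x i / st_r x i * sin (st_s x i) * steer_rate P x i
     + (st_v x i / st_r x i)\<^sup>2 * sin (st_s x i) * cos (st_s x i)"

context
  fixes w0 :: "'n state" and w :: "real \<Rightarrow> 'n state"
  assumes sol: "solves_ivp P w0 {0..} w"
begin

lemma sol_in: "0 \<le> t \<Longrightarrow> w t \<in> sublevel P (H_R P w0)" "0 \<le> t \<Longrightarrow> w t \<in> Omega P"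
  using solves_ivp_stays[OF sol, of t] by (auto simp: sublevel_def)

lemma sol_derivative: "0 \<le> t \<Longrightarrow> (w has_vector_derivative cruise_field P (w t)) (at t within {0..})"
  using sol unfolding solves_ivp_def cruise_field_def by auto

lemma sol_component_derivatives:
  assumes "0 \<le> t"
  shows "((\<lambda>t. st_r (w t) i) has_real_derivative - st_v (w t) i * sin (st_s (w t) i)) (at t within {0..})"
    "((\<lambda>t. st_s (w t) i) has_real_derivative steer_rate P (w t) i) (at t within {0..})"
    "((\<lambda>t. st_v (w t) i) has_real_derivative F_law P (w t) i) (at t within {0..})"
  using component_has_derivative[OF sol_derivative[OF assms], of i]
  unfolding cruise_field_components[OF sol_in(2)[OF assms]] by auto

lemma sol_lipschitz: "\<exists>M. M-lipschitz_on {0..} w"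
proof -
  have "bounded (cruise_field P ` sublevel P (H_R P w0))"
    by (rule sublevel_bounded) (auto intro: lipschitz_near_cruise_field cruise_field_turn)
  then obtain M where M: "\<And>x. x \<in> sublevel P (H_R P w0) \<Longrightarrow> norm (cruise_field P x) \<le> M"
    unfolding bounded_iff by blast
  have "M-lipschitz_on {0..} w"
  proof (rule bounded_derivative_imp_lipschitz)
    show "(w has_derivative (\<lambda>h. h *\<^sub>R cruise_field P (w t))) (at t within {0..})" if "t \<in> {0..}" for t
      using sol_derivative that unfolding has_vector_derivative_def by simp
    show "onorm (\<lambda>h. h *\<^sub>R cruise_field P (w t)) \<le> M" if "t \<in> {0..}" for t
    proof (rule onorm_le)
      show "norm (h *\<^sub>R cruise_field P (w t)) \<le> M * norm h" for h
        using mult_right_mono[OF M[OF sol_in(1)], of t "\<bar>h\<bar>"] that by (simp add: mult.commute)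
    qed
    show "0 \<le> M" using M[OF sol_in(1), of 0] norm_ge_zero order_trans by blast
  qed auto
  then show ?thesis ..
qed

text \<open>
A solution moves with bounded speed, and on its sublevel set \<open>f\<close> is uniformly Lipschitz at small
distances.
\<close>

lemma sol_uniformly_continuous:
  fixes f :: "'n state \<Rightarrow> real"
  assumes "\<And>w. w \<in> Omega P \<Longrightarrow> lipschitz_near f w" "\<And>w k. f (w + turn k) = f w"
  shows "uniformly_continuous_on {0..} (\<lambda>t. f (w t))"
  unfolding uniformly_continuous_on_def
proof (intro allI impI)
  fix e :: real assume e: "e > 0"
  obtain d L where d: "d > 0" and L: "L \<ge> 0"
    and near: "\<And>x y. x \<in> sublevel P (H_R P w0) \<Longrightarrow> dist x y < d \<Longrightarrow> dist (f x) (f y) \<le> L * dist x y"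
    using sublevel_lipschitz[of f "H_R P w0", OF assms] by metis
  define k where "k = min d (e / (L + 1))"
  have k: "k > 0" "k \<le> d" "k \<le> e / (L + 1)" using d e L by (auto simp: k_def)
  obtain M where "M-lipschitz_on {0..} w" using sol_lipschitz by blast
  then have "uniformly_continuous_on {0..} w" by (rule lipschitz_on_uniformly_continuous)
  then obtain r where r: "r > 0" "\<And>s t. 0 \<le> s \<Longrightarrow> 0 \<le> t \<Longrightarrow> dist t s < r \<Longrightarrow> dist (w t) (w s) < k"
    using k(1) unfolding uniformly_continuous_on_def by (metis atLeast_iff)
  show "\<exists>r>0. \<forall>s\<in>{0..}. \<forall>t\<in>{0..}. dist t s < r \<longrightarrow> dist (f (w t)) (f (w s)) < e"
  proof (intro exI conjI ballI impI)
    fix s t :: real assume st: "s \<in> {0..}" "t \<in> {0..}" "dist t s < r"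
    then have ws: "dist (w t) (w s) < k" using r(2) by simp
    have "dist (f (w t)) (f (w s)) \<le> L * dist (w t) (w s)"
      using ws k(2) st by (intro near sol_in) auto
    also have "\<dots> \<le> L * k" using ws L by (intro mult_left_mono) auto
    also have "\<dots> < (L + 1) * k" using k by simp
    also have "\<dots> \<le> e" using k(3) L by (simp add: pos_le_divide_eq mult.commute)
    finally show "dist (f (w t)) (f (w s)) < e" .
  qed (rule r(1))
qed

lemma sol_H_R_converges: "\<exists>l. ((\<lambda>t. H_R P (w t)) \<longlongrightarrow> l) at_top"
proof -
  have mono: "H_R P (w b) \<le> H_R P (w a)" if "0 \<le> a" "a \<le> b" for a b
  proof -
    \<comment> \<open>shifting time makes \<open>a\<close> the initial time\<close>
    have "((\<lambda>t. w (a + t)) has_vector_derivative 1 *\<^sub>R cruise_field P (w (a + t))) (at t within {0..b-a})"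
      if t: "t \<in> {0..b-a}" for t
    proof -
      have "(w has_vector_derivative cruise_field P (w (a + t))) (at (a + t) within (\<lambda>t. a + t) ` {0..b-a})"
        using t \<open>0 \<le> a\<close> by (intro has_vector_derivative_within_subset[OF sol_derivative]) auto
      moreover have "((\<lambda>t. a + t) has_vector_derivative 1) (at t within {0..b-a})"
        by (auto intro!: derivative_eq_intros)
      ultimately show ?thesis
        using vector_diff_chain_within[of "\<lambda>t. a + t" 1 t "{0..b-a}" w] by (simp add: o_def)
    qed
    then have "H_R P (w (a + (b - a))) \<le> H_R P (w (a + 0))"
      using that by (intro H_R_nonincreasing[where a="\<lambda>_. 1" and w="\<lambda>t. w (a + t)"] sol_in) auto
    then show ?thesis by simp
  qed
  define h where "h t = H_R P (w t)" for t
  have h0: "0 \<le> h t" if "0 \<le> t" for t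
    unfolding h_def by (rule H_R_terms_le(5)[OF sol_in(2)[OF that]])
  define l where "l = Inf (h ` {0..})"
  have bb: "bdd_below (h ` {0..})" using h0 by (intro bdd_belowI2[of _ 0]) auto
  have "(h \<longlongrightarrow> l) at_top"
  proof (rule decreasing_tendsto)
    show "\<forall>\<^sub>F t in at_top. l \<le> h t"
      using eventually_ge_at_top[of 0]
      by eventually_elim (auto simp: l_def intro: cInf_lower[OF _ bb])
    fix x assume "l < x"
    then obtain s where s: "0 \<le> s" "h s < x"
      using cInf_lessD[of "h ` {0..}" x] by (auto simp: l_def)
    show "\<forall>\<^sub>F t in at_top. h t < x"
      using eventually_ge_at_top[of s]
      by eventually_elim (use mono[OF s(1)] s(2) in \<open>auto simp: h_def intro: le_less_trans\<close>)
  qed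
  then show ?thesis unfolding h_def by blast
qed

text \<open>
This is stated for any part \<open>f\<close> of the dissipation of one vehicle, so that the errors of the angular
speed and of the heading can be treated separately.
\<close>

lemma sol_dissipation_vanishes:
  assumes lip: "\<And>w. w \<in> Omega P \<Longrightarrow> lipschitz_near f w" "\<And>w k. f (w + turn k) = f w"
    and le: "\<And>w. w \<in> Omega P \<Longrightarrow> f w \<le> (ang_speed w i - omega P) * f1 P (ang_speed w i - omega P)
         + sin (st_s w i) * f2 P (sin (st_s w i))"
    and e: "e > 0"
  shows "\<forall>\<^sub>F t in at_top. f (w t) < e"
proof -
  obtain l where l: "((\<lambda>t. H_R P (w t)) \<longlongrightarrow> l) at_top" using sol_H_R_converges by blast
  show ?thesis
  proof (rule barbalat[OF l _ _ sol_uniformly_continuous[OF lip] e])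
    fix t :: real assume t: "0 \<le> t"
    show "((\<lambda>t. H_R P (w t)) has_real_derivative lyap_slope P (w t) (cruise_field P (w t))) (at t within {0..})"
      by (rule H_R_has_derivative[OF sol_derivative[OF t] sol_in(2)[OF t]])
    have "f (w t) \<le> (\<Sum>i\<in>UNIV. (ang_speed (w t) i - omega P) * f1 P (ang_speed (w t) i - omega P)
         + sin (st_s (w t) i) * f2 P (sin (st_s (w t) i)))"
      by (rule order_trans[OF le[OF sol_in(2)[OF t]]], rule member_le_sum) (auto simp: dissipation_nonneg)
    then show "lyap_slope P (w t) (cruise_field P (w t)) \<le> - f (w t)"
      using lyap_slope_cruise[OF sol_in(2)[OF t]] by linarith
  qed
qed

lemma sol_eventually_in: "\<forall>\<^sub>F t in at_top. 0 \<le> t \<and> w t \<in> Omega P"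
  using eventually_ge_at_top[of 0] by eventually_elim (simp add: sol_in)

lemma sol_ang_speed_limit: "((\<lambda>t. ang_speed (w t) i) \<longlongrightarrow> omega P) at_top"
proof -
  have "((\<lambda>t. ang_speed (w t) i - omega P) \<longlongrightarrow> 0) at_top"
  proof (rule tendsto_zero_of_positive_definite[where \<phi>="\<lambda>x. x * f1 P x"])
    show "continuous_on UNIV (\<lambda>x. x * f1 P x)" by (intro continuous_intros damping_continuous)
    show "0 < x * f1 P x" if "x \<noteq> 0" for x using feedback_functions(7)[OF that] .
    show "\<forall>\<^sub>F t in at_top. \<bar>ang_speed (w t) i - omega P\<bar> \<le> vmax P / Rin P + omega P"
      using sol_eventually_in by eventually_elim (simp add: ang_speed_bound)
    show "\<forall>\<^sub>F t in at_top. (ang_speed (w t) i - omega P) * f1 P (ang_speed (w t) i - omega P) < e"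
      if "e > 0" for e
      by (rule sol_dissipation_vanishes[OF _ _ _ that, where i=i and
            f="\<lambda>w. (ang_speed w i - omega P) * f1 P (ang_speed w i - omega P)"])
        (auto intro!: lipschitz_near_intros simp: turn_invariant damping_nonneg)
  qed
  then show ?thesis by (simp add: LIM_zero_iff)
qed

lemma sol_heading_limit: "((\<lambda>t. st_s (w t) i) \<longlongrightarrow> 0) at_top"
proof -
  have "((\<lambda>t. sin (st_s (w t) i)) \<longlongrightarrow> 0) at_top"
  proof (rule tendsto_zero_of_positive_definite[where \<phi>="\<lambda>x. x * f2 P x"])
    show "continuous_on UNIV (\<lambda>x. x * f2 P x)" by (intro continuous_intros damping_continuous)
    show "0 < x * f2 P x" if "x \<noteq> 0" for x using feedback_functions(10)[OF that] .
    show "\<forall>\<^sub>F t in at_top. \<bar>sin (st_s (w t) i)\<bar> \<le> 1" by simp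
    show "\<forall>\<^sub>F t in at_top. sin (st_s (w t) i) * f2 P (sin (st_s (w t) i)) < e" if "e > 0" for e
      by (rule sol_dissipation_vanishes[OF _ _ _ that, where i=i and
            f="\<lambda>w. sin (st_s w i) * f2 P (sin (st_s w i))"])
        (auto intro!: lipschitz_near_intros simp: turn_invariant damping_nonneg)
  qed
  then have "((\<lambda>t. arcsin (sin (st_s (w t) i))) \<longlongrightarrow> arcsin 0) at_top"
    by (rule isCont_tendsto_compose[rotated]) (rule isCont_arcsin; simp)
  moreover have "\<forall>\<^sub>F t in at_top. arcsin (sin (st_s (w t) i)) = st_s (w t) i"
    using sol_eventually_in
  proof eventually_elim
    case (elim t)
    then show ?case using OmegaD(4,5)[of "w t" i] parameter_bounds(7) by (intro arcsin_sin) auto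
  qed
  ultimately show ?thesis using tendsto_cong by force
qed

lemma sol_steer_limit: "((\<lambda>t. steer_rate P (w t) i) \<longlongrightarrow> 0) at_top"
  by (rule derivative_tendsto_zero[OF sol_heading_limit sol_component_derivatives(2)])
    (auto intro!: sol_uniformly_continuous lipschitz_near_closed_loop simp: turn_invariant_closed_loop)

lemma sol_speed_limit: "((\<lambda>t. st_v (w t) i / st_r (w t) i) \<longlongrightarrow> omega P) at_top"
proof -
  have "((\<lambda>t. ang_speed (w t) i / cos (st_s (w t) i)) \<longlongrightarrow> omega P / cos 0) at_top"
    by (intro tendsto_intros sol_ang_speed_limit sol_heading_limit) simp
  moreover have "\<forall>\<^sub>F t in at_top. ang_speed (w t) i / cos (st_s (w t) i) = st_v (w t) i / st_r (w t) i"
    using sol_eventually_in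
  proof eventually_elim
    case (elim t)
    then show ?case using OmegaD(9)[of "w t" i] by (simp add: ang_speed_def)
  qed
  ultimately show ?thesis using tendsto_cong by force
qed

lemma sol_ang_rate_limit: "((\<lambda>t. ang_rate (w t) i) \<longlongrightarrow> 0) at_top"
proof (rule derivative_tendsto_zero[OF sol_ang_speed_limit])
  show "((\<lambda>t. ang_speed (w t) i) has_real_derivative ang_rate (w t) i) (at t within {0..})"
    if t: "0 \<le> t" for t
    unfolding ang_speed_def ang_rate_def
    using OmegaD(3)[OF sol_in(2)[OF t], of i]
    by (auto intro!: derivative_eq_intros sol_component_derivatives t simp: field_simps power2_eq_square)
  have nz: "st_r x i \<noteq> 0" if "x \<in> Omega P" for x using OmegaD(3)[OF that, of i] by simp
  show "uniformly_continuous_on {0..} (\<lambda>t. ang_rate (w t) i)"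
    unfolding ang_rate_def
    by (rule sol_uniformly_continuous)
      (auto intro!: lipschitz_near_intros nz simp: turn_invariant_closed_loop)
qed

text \<open>
In the rate of change of the angular speed, all terms but the one with \<open>F\<close> contain \<open>sin s\<close> and
bounded factors, and the coefficient of \<open>F\<close> is bounded away from zero.
\<close>

lemma sol_F_limit: "((\<lambda>t. F_law P (w t) i) \<longlongrightarrow> 0) at_top"
proof -
  have "((\<lambda>t. ang_rate (w t) i
     + st_v (w t) i / st_r (w t) i * sin (st_s (w t) i) * steer_rate P (w t) i
     - (st_v (w t) i / st_r (w t) i)\<^sup>2 * sin (st_s (w t) i) * cos (st_s (w t) i))
     \<longlongrightarrow> 0 + omega P * sin 0 * 0 - (omega P)\<^sup>2 * sin 0 * cos 0) at_top"
    by (intro tendsto_intros sol_ang_rate_limit sol_speed_limit sol_heading_limit sol_steer_limit)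
  then have "((\<lambda>t. F_law P (w t) i * cos (st_s (w t) i) / st_r (w t) i) \<longlongrightarrow> 0) at_top"
    by (simp add: ang_rate_def)
  then have lim: "((\<lambda>t. \<bar>F_law P (w t) i * cos (st_s (w t) i) / st_r (w t) i\<bar> * (Rout P / cos (Theta P)))
      \<longlongrightarrow> 0) at_top"
    by (intro tendsto_mult_left_zero tendsto_rabs_zero)
  show ?thesis
  proof (rule Lim_null_comparison[OF _ lim])
    show "\<forall>\<^sub>F t in at_top. norm (F_law P (w t) i)
      \<le> \<bar>F_law P (w t) i * cos (st_s (w t) i) / st_r (w t) i\<bar> * (Rout P / cos (Theta P))"
      using sol_eventually_in
    proof eventually_elim
      case (elim t)
      note O = OmegaD[of "w t" i, OF conjunct2[OF elim]]
      have "\<bar>F_law P (w t) i\<bar> = \<bar>F_law P (w t) i * cos (st_s (w t) i) / st_r (w t) i\<bar>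
          * (st_r (w t) i / cos (st_s (w t) i))"
        using O by (simp add: abs_mult)
      also have "\<dots> \<le> \<bar>F_law P (w t) i * cos (st_s (w t) i) / st_r (w t) i\<bar> * (Rout P / cos (Theta P))"
        using O cos_Theta by (intro mult_left_mono frac_le) auto
      finally show ?case by simp
    qed
  qed
qed

lemma sol_heading_deriv_limit: "((\<lambda>t. deriv (\<lambda>\<tau>. st_s (w \<tau>) i) t) \<longlongrightarrow> 0) at_top"
proof -
  have "\<forall>\<^sub>F t in at_top. steer_rate P (w t) i = deriv (\<lambda>\<tau>. st_s (w \<tau>) i) t"
    using eventually_gt_at_top[of "0::real"]
  proof eventually_elim
    case (elim t)
    then have "at t within {0..} = at t" by (intro at_within_interior) simp
    then have "((\<lambda>t. st_s (w t) i) has_real_derivative steer_rate P (w t) i) (at t)"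
      using sol_component_derivatives(2)[of t i] elim by simp
    then show ?case by (rule DERIV_imp_deriv[symmetric])
  qed
  then show ?thesis using tendsto_cong sol_steer_limit by force
qed

end

end

section \<open>Global behaviour of the closed loop\<close>

theorem theorem2:
  fixes P :: "'n::finite params"
  assumes "admissible P"
  shows "(\<forall>w0 \<in> Omega P. \<exists>w.
            solves_ivp P w0 {0..} w \<and>
            (\<forall>J u. is_interval J \<and> 0 \<in> J \<and> J \<subseteq> {0..} \<and> solves_ivp P w0 J u
                    \<longrightarrow> (\<forall>t\<in>J. u t = w t)) \<and>
            (\<forall>i. ((\<lambda>t. st_s (w t) i) \<longlongrightarrow> 0) at_top \<and>
                 ((\<lambda>t. st_v (w t) i / st_r (w t) i) \<longlongrightarrow> omega P) at_top \<and>
                 ((\<lambda>t. deriv (\<lambda>\<tau>. st_s (w \<tau>) i) t) \<longlongrightarrow> 0) at_top \<and>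
                 ((\<lambda>t. F_law P (w t) i) \<longlongrightarrow> 0) at_top)) \<and>
         (\<exists>P2 :: real \<Rightarrow> real.
            mono_on {0..} P2 \<and> (\<forall>x\<ge>0. 0 \<le> P2 x) \<and>
            (\<forall>w0 \<in> Omega P. \<forall>w. solves_ivp P w0 {0..} w \<longrightarrow>
               (\<forall>t\<ge>0. \<forall>i. \<bar>F_law P (w t) i\<bar> + \<bar>delta_law P (w t) i\<bar> \<le> P2 (H_R P w0))))"
proof -
  interpret admissible_params P by unfold_locales (rule assms)
  show ?thesis
  proof (rule conjI, intro ballI)
    fix w0 assume "w0 \<in> Omega P"
    then obtain w where w: "solves_ivp P w0 {0..} w" using global_solution by blast
    have "u t = w t" if J: "is_interval J" "0 \<in> J" "J \<subseteq> {0..}" "solves_ivp P w0 J u" "t \<in> J" for J u t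
    proof (rule solution_unique[OF J(4) _ w])
      show "{0..t} \<subseteq> J" using J unfolding is_interval_1 by (meson atLeastAtMost_iff subsetI)
    qed (use J in auto)
    then show "\<exists>w. solves_ivp P w0 {0..} w \<and>
            (\<forall>J u. is_interval J \<and> 0 \<in> J \<and> J \<subseteq> {0..} \<and> solves_ivp P w0 J u
                    \<longrightarrow> (\<forall>t\<in>J. u t = w t)) \<and>
            (\<forall>i. ((\<lambda>t. st_s (w t) i) \<longlongrightarrow> 0) at_top \<and>
                 ((\<lambda>t. st_v (w t) i / st_r (w t) i) \<longlongrightarrow> omega P) at_top \<and>
                 ((\<lambda>t. deriv (\<lambda>\<tau>. st_s (w \<tau>) i) t) \<longlongrightarrow> 0) at_top \<and>
                 ((\<lambda>t. F_law P (w t) i) \<longlongrightarrow> 0) at_top)"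
      using w sol_heading_limit[OF w] sol_speed_limit[OF w] sol_heading_deriv_limit[OF w] sol_F_limit[OF w]
      by (intro exI[of _ w]) blast
  next
    obtain B where B: "mono_on {0..} B" "\<And>x. x \<ge> 0 \<Longrightarrow> 0 \<le> (B x :: real)"
      "\<And>c x i. c \<ge> 0 \<Longrightarrow> x \<in> sublevel P c \<Longrightarrow> \<bar>F_law P x i\<bar> \<le> B c"
      using F_law_bound by metis
    show "\<exists>P2 :: real \<Rightarrow> real.
            mono_on {0..} P2 \<and> (\<forall>x\<ge>0. 0 \<le> P2 x) \<and>
            (\<forall>w0 \<in> Omega P. \<forall>w. solves_ivp P w0 {0..} w \<longrightarrow>
               (\<forall>t\<ge>0. \<forall>i. \<bar>F_law P (w t) i\<bar> + \<bar>delta_law P (w t) i\<bar> \<le> P2 (H_R P w0)))"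
    \<comment> \<open>the steering angles are values of the arctangent\<close>
    proof (intro exI[of _ "\<lambda>x. B x + pi / 2"] conjI ballI allI impI)
      show "mono_on {0..} (\<lambda>x. B x + pi / 2)"
        using B(1) by (auto simp: mono_on_def)
      show "0 \<le> B x + pi / 2" if "0 \<le> x" for x using B(2)[OF that] by (simp add: add_nonneg_nonneg)
      fix w0 w t i
      assume w0: "w0 \<in> Omega P" and w: "solves_ivp P w0 {0..} w" and t: "0 \<le> (t::real)"
      have "\<bar>F_law P (w t) i\<bar> \<le> B (H_R P w0)"
        by (rule B(3)[OF H_R_terms_le(5)[OF w0] sol_in(1)[OF w t]])
      moreover have "\<bar>delta_law P (w t) i\<bar> \<le> pi / 2"
        unfolding delta_law_def abs_le_iff using arctan_bounded by (smt (verit))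
      ultimately show "\<bar>F_law P (w t) i\<bar> + \<bar>delta_law P (w t) i\<bar> \<le> B (H_R P w0) + pi / 2"
        by linarith
    qed
  qed
qed

end
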